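(* Let $R$ be a commutative ring with $1\neq 0$, let $\tau$ be a symmetric relation on $R^{\#}$, and let $\tau_{\mathrm{reg}}:=\tau\cap(\mathrm{Reg}(R)\times\mathrm{Reg}(R))$. Let $\alpha\in\{$atomic, strongly atomic, m-atomic, unrefinably atomic$\}$ and $\beta\in\{$associate, strongly associate$\}$. Then for any choice of $\alpha$ and $\beta$, the following hold. (1) $R$ is $\tau_{\mathrm{reg}}$-U-$\alpha$ if and only if $R$ is $\tau_{\mathrm{reg}}$-$\alpha$ if and only if $R$ is $\tau$-regular-atomic. (2) $R$ satisfies $\tau_{\mathrm{reg}}$-U-ACCP if and only if $R$ satisfies $\tau_{\mathrm{reg}}$-ACCP if and only if $R$ satisfies $\tau$-regular-ACCP. (3) $R$ is a $\tau_{\mathrm{reg}}$-U-$\alpha$-$\beta$-UFR if and only if $R$ is a $\tau_{\mathrm{reg}}$-$\alpha$-$\beta$-UFR if and only if $R$ is a $\tau$-regular-UFR. (4) $R$ is a $\tau_{\mathrm{reg}}$-U-$\alpha$-HFR if and only if $R$ is a $\tau_{\mathrm{reg}}$-$\alpha$-HFR if and only if $R$ is a $\tau$-regular-HFR. (5) $R$ is a $\tau_{\mathrm{reg}}$-U-BFR if and only if $R$ is a $\tau_{\mathrm{reg}}$-BFR if and only if $R$ is a $\tau$-regular-BFR. (6) $R$ is a $\tau_{\mathrm{reg}}$-U-$\alpha$-$\beta$-df ring if and only if $R$ is a $\tau_{\mathrm{reg}}$-$\alpha$-$\beta$-df ring if and only if $R$ is a $\tau$-regular-idf ring. (7) $R$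 is a $\tau_{\mathrm{reg}}$-U-$\alpha$, $\tau_{\mathrm{reg}}$-U-$\alpha$-$\beta$-df ring if and only if $R$ is a $\tau_{\mathrm{reg}}$-$\alpha$, $\tau_{\mathrm{reg}}$-$\alpha$-$\beta$-df ring if and only if $R$ is a $\tau$-regular-atomic, $\tau$-regular-idf ring. (8) $R$ is a $\tau_{\mathrm{reg}}$-U-$\beta$-WFFR if and only if $R$ is a $\tau_{\mathrm{reg}}$-$\beta$-WFFR if and only if $R$ is a $\tau$-regular-WFFR. (9) $R$ is a $\tau_{\mathrm{reg}}$-U-$\beta$-FFR if and only if $R$ is a $\tau_{\mathrm{reg}}$-$\beta$-FFR if and only if $R$ is a $\tau$-regular-FFR. Moreover, if $\tau$ is refinable, then the properties of $R$ appearing in (7), (8) and (9) are all equivalent to one another.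
   Context: $U(R)$ is the group of units of $R$, $R^{\#}$ the set of nonzero non-units, $\mathrm{Reg}(R)$ the set of regular elements (non-zero-divisors), $\mathrm{Reg}(R)^{\#}$ the set of regular non-units. $a\sim b$ ($a,b$ associate) means $(a)=(b)$; $a\approx b$ (strongly associate) means $a=\lambda b$ for some $\lambda\in U(R)$. Empty products equal $1$. For any symmetric relation $\sigma$ on $R^{\#}$ (the definitions below are applied to $\sigma=\tau$ and $\sigma=\tau_{\mathrm{reg}}$): a $\sigma$-factorization of a non-unit $a$ is an expression $a=\lambda a_1\cdots a_n$, $n\ge1$, $\lambda\in U(R)$, each $a_i$ a non-unit, $a_i\,\sigma\,a_j$ for all $i\ne j$; it is trivial if $n=1$. The $a_i$ are its $\sigma$-factors, or $\sigma$-divisors of $a$, and $b\mid_\sigma a$ means $b$ is a $\sigma$-factor in some $\sigma$-factorization of $a$; a non-trivial $\sigma$-divisor is a factor of a non-trivial $\sigma$-factorization. $\sigma$ is refinable if, whenever $\lambda a_1\cdots a_n$ and $a_i=\lambda_ib_{i1}\cdots b_{im_i}$ ($1\le i\le n$) are $\sigma$-factorizations, so is $(\lambda\lambda_1\cdots\lambda_n)b_{11}\cdots b_{1m_1}\cdots b_{n1}\cdots b_{nm_n}$. A non-unit $a$ is $\sigma$-atomic (resp. $\sigma$-strongly atomic, $\sigma$-m-atomic) if for every $\sigma$-factorization $a=\lambda a_1\cdots a_n$ one has $a\sim a_i$ for some $i$ (resp. $a\approx a_i$ for some $i$, $a\sim a_i$ for all $i$); $a$ is $\sigma$-unrefinably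 atomic if it has only trivial $\sigma$-factorizations. A $\sigma$-$\alpha$-factorization is a $\sigma$-factorization all of whose factors are $\sigma$-$\alpha$. $R$ is $\sigma$-$\alpha$ if every non-unit has a $\sigma$-$\alpha$-factorization. $R$ satisfies $\sigma$-ACCP if every chain $(a_0)\subseteq(a_1)\subseteq\cdots$ with $a_{i+1}\mid_\sigma a_i$ for all $i$ is eventually constant. $R$ is a $\sigma$-$\alpha$-HFR if it is $\sigma$-$\alpha$ and any two $\sigma$-$\alpha$-factorizations of the same non-unit have the same length; it is a $\sigma$-$\alpha$-$\beta$-UFR if moreover the factors can be rearranged so that corresponding ones are $\beta$. $R$ is a $\sigma$-BFR if for every non-unit $a$ there is $N(a)\in\mathbb N$ bounding the length of every $\sigma$-factorization of $a$. $R$ is a $\sigma$-$\beta$-FFR if every non-unit has only finitely many non-trivial $\sigma$-factorizations up to rearrangement and $\beta$. $R$ is a $\sigma$-$\beta$-WFFR if every non-unit has only finitely many non-trivial $\sigma$-divisors up to $\beta$. $R$ is a $\sigma$-$\alpha$-$\beta$-df ring if every non-unit has only finitely many $\sigma$-$\alpha$ $\sigma$-divisors up to $\beta$. U-factorizations: a U-factorization of a non-unit $a$ is a factorization $a=\lambda a_1\cdots a_nb_1\cdots b_m$ ($n\ge0$, $m\ge1$, $\lambda\in U(R)$, all $a_i,b_j$ non-units), written $a=\lambda a_1\cdots a_n\lceil b_1\cdots b_m\rceil$, such that $a_i(b_1\cdots b_m)=(b_1\cdots b_m)$ for all $i$ and $b_j(b_1\cdots\widehat{b_j}\cdots b_m)\ne(b_1\cdots\widehat{b_j}\cdots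 b_m)$ for all $j$ (equality of principal ideals, $\widehat{b_j}$ meaning $b_j$ is omitted). The $b_j$ are its essential divisors and the $a_i$ its inessential divisors. It is a $\sigma$-U-factorization if $\lambda a_1\cdots a_nb_1\cdots b_m$ is a $\sigma$-factorization, and a $\sigma$-U-$\alpha$-factorization if moreover every $b_j$ is $\sigma$-$\alpha$. $R$ is $\sigma$-U-$\alpha$ if every non-unit has a $\sigma$-U-$\alpha$-factorization. $R$ satisfies $\sigma$-U-ACCP if there is no infinite properly ascending chain $(a_1)\subsetneq(a_2)\subsetneq\cdots$ with $a_{i+1}$ an essential divisor in some $\sigma$-U-factorization of $a_i$ for each $i$. $R$ is a $\sigma$-U-BFR if for every non-unit $a$ there is a bound on the number of essential divisors in any $\sigma$-U-factorization of $a$. $R$ is a $\sigma$-U-$\beta$-FFR if every non-unit has only finitely many $\sigma$-U-factorizations up to rearrangement of the essential divisors and $\beta$. $R$ is a $\sigma$-U-$\beta$-WFFR if for every non-unit $a$ there are only finitely many essential divisors among all $\sigma$-U-factorizations of $a$ up to $\beta$. $R$ is a $\sigma$-U-$\alpha$-$\beta$-df ring if for every non-unit $a$ there are only finitely many $\sigma$-$\alpha$ essential divisors, up to $\beta$, in the $\sigma$-U-factorizations of $a$. $R$ is a $\sigma$-U-$\alpha$-HFR if it is $\sigma$-U-$\alpha$ and for every non-unit $a$ the number of essential divisors is the same in all $\sigma$-U-$\alpha$-factorizations of $a$; it is a $\sigma$-U-$\alpha$-$\beta$-UFR if moreover the essential divisors of any two $\sigma$-U-$\alpha$-factorizations of $a$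 can be rearranged to match up to $\beta$. $\tau$-regular notions: a $\tau$-regular-factorization is a $\tau$-factorization of an element of $\mathrm{Reg}(R)$. A regular non-unit $a$ is $\tau$-$r$-irreducible if for every $\tau$-regular-factorization $a=\lambda a_1\cdots a_n$ one has $a\sim a_i$ for some $i$ (equivalently, it has only trivial ones). $R$ is $\tau$-regular-atomic if every $a\in\mathrm{Reg}(R)^{\#}$ has a $\tau$-regular-factorization into $\tau$-$r$-irreducibles (a $\tau$-$r$-atomic factorization). $R$ satisfies $\tau$-regular-ACCP if there is no infinite chain $(a_1)\subsetneq(a_2)\subsetneq\cdots$ with all $a_i$ regular and $a_{i+1}$ a $\tau$-factor in some $\tau$-regular-factorization of $a_i$. $R$ is a $\tau$-regular-HFR if it is $\tau$-regular-atomic and any two $\tau$-$r$-atomic factorizations of the same element have the same length; a $\tau$-regular-UFR if moreover the factors can be rearranged to be pairwise associate. $R$ is a $\tau$-regular-BFR if for each $a\in\mathrm{Reg}(R)$ there is a bound on the lengths of $\tau$-regular-factorizations of $a$. $R$ is a $\tau$-regular-idf ring if each $a\in\mathrm{Reg}(R)^{\#}$ has only finitely many $\tau$-$r$-irreducible $\tau$-divisors up to associates; a $\tau$-regular-WFFR if each $a\in\mathrm{Reg}(R)^{\#}$ has only finitely many $\tau$-divisors up to associates; a $\tau$-regular-FFR if each $a\in\mathrm{Reg}(R)^{\#}$ has only finitely many $\tau$-factorizations up to order and associates. *)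

theory Defs
  imports "HOL-Library.Multiset"
begin

text \<open>
  The ring \<open>R\<close> is a type of class \<^class>\<open>comm_ring_1\<close> (which includes \<open>1 \<noteq> 0\<close>), and
  relations on it are sets of pairs. The unit group \<open>U(R)\<close> is \<open>{u. u dvd 1}\<close>.
\<close>

definition nonzero_nonunits :: "'a::comm_ring_1 set" where
  "nonzero_nonunits = {a. a \<noteq> 0 \<and> \<not> a dvd 1}"

definition Reg :: "'a::comm_ring_1 set" where
  "Reg = {a. \<forall>x. a * x = 0 \<longrightarrow> x = 0}"

definition Reg_nonunits :: "'a::comm_ring_1 set" where
  "Reg_nonunits = {a \<in> Reg. \<not> a dvd 1}"

definition tau_reg :: "('a::comm_ring_1 \<times> 'a) set \<Rightarrow> ('a \<times> 'a) set" where
  "tau_reg \<tau> = \<tau> \<inter> (Reg \<times> Reg)"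

definition pideal :: "'a::comm_ring_1 \<Rightarrow> 'a set" where
  "pideal a = {r * a | r. True}"

definition associate :: "'a::comm_ring_1 \<Rightarrow> 'a \<Rightarrow> bool" where
  "associate a b \<longleftrightarrow> pideal a = pideal b"

definition strongly_associate :: "'a::comm_ring_1 \<Rightarrow> 'a \<Rightarrow> bool" where
  "strongly_associate a b \<longleftrightarrow> (\<exists>u. u dvd 1 \<and> a = u * b)"

datatype atom_kind = Atomic | Strongly_Atomic | M_Atomic | Unrefinably_Atomic

datatype assoc_kind = Associate | Strongly_Associate

fun assoc_by :: "assoc_kind \<Rightarrow> 'a::comm_ring_1 \<Rightarrow> 'a \<Rightarrow> bool" where
  "assoc_by Associate a b = associate a b"
| "assoc_by Strongly_Associate a b = strongly_associate a b"

text \<open>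
  ``Only finitely many elements of \<open>S\<close> up to \<open>r\<close>'', for an equivalence relation \<open>r\<close>: the set of
  equivalence classes is finite.
\<close>

definition finite_up_to :: "('b \<Rightarrow> 'b \<Rightarrow> bool) \<Rightarrow> 'b set \<Rightarrow> bool" where
  "finite_up_to r S \<longleftrightarrow> finite (S // {(x, y). r x y})"


section \<open>Factorizations with respect to a relation\<close>

text \<open>
  The expression \<open>a = \<lambda> a\<^sub>1 \<cdots> a\<^sub>n\<close> is recorded as the unit \<open>l\<close> together with the list \<open>xs\<close> of factors.
\<close>

definition factorization :: "('a::comm_ring_1 \<times> 'a) set \<Rightarrow> 'a \<Rightarrow> 'a \<Rightarrow> 'a list \<Rightarrow> bool" where
  "factorization \<sigma> a l xs \<longleftrightarrow>
     \<not> a dvd 1 \<and> a = l * prod_list xs \<and> l dvd 1 \<and> length xs \<ge> 1 \<and>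
     (\<forall>x\<in>set xs. \<not> x dvd 1) \<and>
     (\<forall>i<length xs. \<forall>j<length xs. i \<noteq> j \<longrightarrow> (xs ! i, xs ! j) \<in> \<sigma>)"

definition sdivisor :: "('a::comm_ring_1 \<times> 'a) set \<Rightarrow> 'a \<Rightarrow> 'a \<Rightarrow> bool" where
  "sdivisor \<sigma> b a \<longleftrightarrow> (\<exists>l xs. factorization \<sigma> a l xs \<and> b \<in> set xs)"

definition nontrivial_sdivisor :: "('a::comm_ring_1 \<times> 'a) set \<Rightarrow> 'a \<Rightarrow> 'a \<Rightarrow> bool" where
  "nontrivial_sdivisor \<sigma> b a \<longleftrightarrow>
     (\<exists>l xs. factorization \<sigma> a l xs \<and> length xs \<noteq> 1 \<and> b \<in> set xs)"

definition refinable :: "('a::comm_ring_1 \<times> 'a) set \<Rightarrow> bool" where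
  "refinable \<sigma> \<longleftrightarrow>
     (\<forall>a l xs ls yss.
        factorization \<sigma> a l xs \<longrightarrow> length ls = length xs \<longrightarrow> length yss = length xs \<longrightarrow>
        (\<forall>i<length xs. factorization \<sigma> (xs ! i) (ls ! i) (yss ! i)) \<longrightarrow>
        factorization \<sigma> a (l * prod_list ls) (concat yss))"

fun atom :: "('a::comm_ring_1 \<times> 'a) set \<Rightarrow> atom_kind \<Rightarrow> 'a \<Rightarrow> bool" where
  "atom \<sigma> Atomic a \<longleftrightarrow>
     \<not> a dvd 1 \<and> (\<forall>l xs. factorization \<sigma> a l xs \<longrightarrow> (\<exists>x\<in>set xs. associate a x))"
| "atom \<sigma> Strongly_Atomic a \<longleftrightarrow>
     \<not> a dvd 1 \<and> (\<forall>l xs. factorization \<sigma> a l xs \<longrightarrow> (\<exists>x\<in>set xs. strongly_associate a x))"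
| "atom \<sigma> M_Atomic a \<longleftrightarrow>
     \<not> a dvd 1 \<and> (\<forall>l xs. factorization \<sigma> a l xs \<longrightarrow> (\<forall>x\<in>set xs. associate a x))"
| "atom \<sigma> Unrefinably_Atomic a \<longleftrightarrow>
     \<not> a dvd 1 \<and> (\<forall>l xs. factorization \<sigma> a l xs \<longrightarrow> length xs = 1)"

definition atom_factorization ::
  "('a::comm_ring_1 \<times> 'a) set \<Rightarrow> atom_kind \<Rightarrow> 'a \<Rightarrow> 'a \<Rightarrow> 'a list \<Rightarrow> bool" where
  "atom_factorization \<sigma> \<alpha> a l xs \<longleftrightarrow>
     factorization \<sigma> a l xs \<and> (\<forall>x\<in>set xs. atom \<sigma> \<alpha> x)"

definition alpha_ring :: "('a::comm_ring_1 \<times> 'a) set \<Rightarrow> atom_kind \<Rightarrow> bool" where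
  "alpha_ring \<sigma> \<alpha> \<longleftrightarrow> (\<forall>a. \<not> a dvd 1 \<longrightarrow> (\<exists>l xs. atom_factorization \<sigma> \<alpha> a l xs))"

definition ACCP :: "('a::comm_ring_1 \<times> 'a) set \<Rightarrow> bool" where
  "ACCP \<sigma> \<longleftrightarrow>
     (\<forall>a :: nat \<Rightarrow> 'a.
        (\<forall>i. pideal (a i) \<subseteq> pideal (a (Suc i)) \<and> sdivisor \<sigma> (a (Suc i)) (a i)) \<longrightarrow>
        (\<exists>N. \<forall>n\<ge>N. pideal (a n) = pideal (a N)))"

definition HFR :: "('a::comm_ring_1 \<times> 'a) set \<Rightarrow> atom_kind \<Rightarrow> bool" where
  "HFR \<sigma> \<alpha> \<longleftrightarrow>
     alpha_ring \<sigma> \<alpha> \<and>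
     (\<forall>a l xs l' xs'. \<not> a dvd 1 \<longrightarrow>
        atom_factorization \<sigma> \<alpha> a l xs \<longrightarrow> atom_factorization \<sigma> \<alpha> a l' xs' \<longrightarrow>
        length xs = length xs')"

text \<open>
  For lists \<open>xs\<close>, \<open>ys\<close>, \<open>rel_mset r (mset xs) (mset ys)\<close> says that they can be rearranged so that
  corresponding entries are related by \<open>r\<close>.
\<close>

definition UFR :: "('a::comm_ring_1 \<times> 'a) set \<Rightarrow> atom_kind \<Rightarrow> assoc_kind \<Rightarrow> bool" where
  "UFR \<sigma> \<alpha> \<beta> \<longleftrightarrow>
     HFR \<sigma> \<alpha> \<and>
     (\<forall>a l xs l' xs'. \<not> a dvd 1 \<longrightarrow>
        atom_factorization \<sigma> \<alpha> a l xs \<longrightarrow> atom_factorization \<sigma> \<alpha> a l' xs' \<longrightarrow>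
        rel_mset (assoc_by \<beta>) (mset xs) (mset xs'))"

definition BFR :: "('a::comm_ring_1 \<times> 'a) set \<Rightarrow> bool" where
  "BFR \<sigma> \<longleftrightarrow>
     (\<forall>a. \<not> a dvd 1 \<longrightarrow> (\<exists>N::nat. \<forall>l xs. factorization \<sigma> a l xs \<longrightarrow> length xs \<le> N))"

text \<open>Comparing factorizations up to rearrangement and \<open>\<beta>\<close> disregards the unit coefficient.\<close>

definition same_factorization ::
  "('a::comm_ring_1 \<Rightarrow> 'a \<Rightarrow> bool) \<Rightarrow> 'a \<times> 'a list \<Rightarrow> 'a \<times> 'a list \<Rightarrow> bool" where
  "same_factorization r = (\<lambda>(l, xs) (l', xs'). rel_mset r (mset xs) (mset xs'))"

definition FFR :: "('a::comm_ring_1 \<times> 'a) set \<Rightarrow> assoc_kind \<Rightarrow> bool" where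
  "FFR \<sigma> \<beta> \<longleftrightarrow>
     (\<forall>a. \<not> a dvd 1 \<longrightarrow>
        finite_up_to (same_factorization (assoc_by \<beta>))
          {(l, xs). factorization \<sigma> a l xs \<and> length xs \<noteq> 1})"

definition WFFR :: "('a::comm_ring_1 \<times> 'a) set \<Rightarrow> assoc_kind \<Rightarrow> bool" where
  "WFFR \<sigma> \<beta> \<longleftrightarrow>
     (\<forall>a. \<not> a dvd 1 \<longrightarrow> finite_up_to (assoc_by \<beta>) {b. nontrivial_sdivisor \<sigma> b a})"

definition df_ring :: "('a::comm_ring_1 \<times> 'a) set \<Rightarrow> atom_kind \<Rightarrow> assoc_kind \<Rightarrow> bool" where
  "df_ring \<sigma> \<alpha> \<beta> \<longleftrightarrow>
     (\<forall>a. \<not> a dvd 1 \<longrightarrow> finite_up_to (assoc_by \<beta>) {b. sdivisor \<sigma> b a \<and> atom \<sigma> \<alpha> b})"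


section \<open>U-factorizations\<close>

text \<open>
  The expression \<open>a = \<lambda> a\<^sub>1 \<cdots> a\<^sub>n \<lceil>b\<^sub>1 \<cdots> b\<^sub>m\<rceil>\<close> is recorded as the unit \<open>l\<close>, the list \<open>xs\<close> of inessential
  divisors (possibly empty) and the nonempty list \<open>ys\<close> of essential divisors. The ideal \<open>x I\<close> is the
  image \<open>(*) x ` I\<close>.
\<close>

definition U_factorization :: "'a::comm_ring_1 \<Rightarrow> 'a \<Rightarrow> 'a list \<Rightarrow> 'a list \<Rightarrow> bool" where
  "U_factorization a l xs ys \<longleftrightarrow>
     \<not> a dvd 1 \<and> a = l * prod_list xs * prod_list ys \<and> l dvd 1 \<and> length ys \<ge> 1 \<and>
     (\<forall>x\<in>set xs. \<not> x dvd 1) \<and> (\<forall>y\<in>set ys. \<not> y dvd 1) \<and>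
     (\<forall>x\<in>set xs. (*) x ` pideal (prod_list ys) = pideal (prod_list ys)) \<and>
     (\<forall>j<length ys.
        (*) (ys ! j) ` pideal (\<Prod>k\<in>{..<length ys} - {j}. ys ! k)
          \<noteq> pideal (\<Prod>k\<in>{..<length ys} - {j}. ys ! k))"

definition sU_factorization ::
  "('a::comm_ring_1 \<times> 'a) set \<Rightarrow> 'a \<Rightarrow> 'a \<Rightarrow> 'a list \<Rightarrow> 'a list \<Rightarrow> bool" where
  "sU_factorization \<sigma> a l xs ys \<longleftrightarrow>
     U_factorization a l xs ys \<and> factorization \<sigma> a l (xs @ ys)"

definition U_atom_factorization ::
  "('a::comm_ring_1 \<times> 'a) set \<Rightarrow> atom_kind \<Rightarrow> 'a \<Rightarrow> 'a \<Rightarrow> 'a list \<Rightarrow> 'a list \<Rightarrow> bool" where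
  "U_atom_factorization \<sigma> \<alpha> a l xs ys \<longleftrightarrow>
     sU_factorization \<sigma> a l xs ys \<and> (\<forall>y\<in>set ys. atom \<sigma> \<alpha> y)"

definition essential_divisor :: "('a::comm_ring_1 \<times> 'a) set \<Rightarrow> 'a \<Rightarrow> 'a \<Rightarrow> bool" where
  "essential_divisor \<sigma> b a \<longleftrightarrow> (\<exists>l xs ys. sU_factorization \<sigma> a l xs ys \<and> b \<in> set ys)"

definition U_alpha_ring :: "('a::comm_ring_1 \<times> 'a) set \<Rightarrow> atom_kind \<Rightarrow> bool" where
  "U_alpha_ring \<sigma> \<alpha> \<longleftrightarrow>
     (\<forall>a. \<not> a dvd 1 \<longrightarrow> (\<exists>l xs ys. U_atom_factorization \<sigma> \<alpha> a l xs ys))"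

definition U_ACCP :: "('a::comm_ring_1 \<times> 'a) set \<Rightarrow> bool" where
  "U_ACCP \<sigma> \<longleftrightarrow>
     \<not> (\<exists>a :: nat \<Rightarrow> 'a.
          \<forall>i. pideal (a i) \<subset> pideal (a (Suc i)) \<and> essential_divisor \<sigma> (a (Suc i)) (a i))"

definition U_HFR :: "('a::comm_ring_1 \<times> 'a) set \<Rightarrow> atom_kind \<Rightarrow> bool" where
  "U_HFR \<sigma> \<alpha> \<longleftrightarrow>
     U_alpha_ring \<sigma> \<alpha> \<and>
     (\<forall>a l xs ys l' xs' ys'. \<not> a dvd 1 \<longrightarrow>
        U_atom_factorization \<sigma> \<alpha> a l xs ys \<longrightarrow> U_atom_factorization \<sigma> \<alpha> a l' xs' ys' \<longrightarrow>
        length ys = length ys')"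

definition U_UFR :: "('a::comm_ring_1 \<times> 'a) set \<Rightarrow> atom_kind \<Rightarrow> assoc_kind \<Rightarrow> bool" where
  "U_UFR \<sigma> \<alpha> \<beta> \<longleftrightarrow>
     U_HFR \<sigma> \<alpha> \<and>
     (\<forall>a l xs ys l' xs' ys'. \<not> a dvd 1 \<longrightarrow>
        U_atom_factorization \<sigma> \<alpha> a l xs ys \<longrightarrow> U_atom_factorization \<sigma> \<alpha> a l' xs' ys' \<longrightarrow>
        rel_mset (assoc_by \<beta>) (mset ys) (mset ys'))"

definition U_BFR :: "('a::comm_ring_1 \<times> 'a) set \<Rightarrow> bool" where
  "U_BFR \<sigma> \<longleftrightarrow>
     (\<forall>a. \<not> a dvd 1 \<longrightarrow>
        (\<exists>N::nat. \<forall>l xs ys. sU_factorization \<sigma> a l xs ys \<longrightarrow> length ys \<le> N))"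

text \<open>
  Two U-factorizations are identified when their essential divisors agree up to rearrangement and
  \<open>\<beta>\<close>; the unit and the inessential divisors are disregarded.
\<close>

definition same_U_factorization ::
  "('a::comm_ring_1 \<Rightarrow> 'a \<Rightarrow> bool) \<Rightarrow>
     'a \<times> 'a list \<times> 'a list \<Rightarrow> 'a \<times> 'a list \<times> 'a list \<Rightarrow> bool" where
  "same_U_factorization r = (\<lambda>(l, xs, ys) (l', xs', ys'). rel_mset r (mset ys) (mset ys'))"

definition U_FFR :: "('a::comm_ring_1 \<times> 'a) set \<Rightarrow> assoc_kind \<Rightarrow> bool" where
  "U_FFR \<sigma> \<beta> \<longleftrightarrow>
     (\<forall>a. \<not> a dvd 1 \<longrightarrow>
        finite_up_to (same_U_factorization (assoc_by \<beta>))
          {(l, xs, ys). sU_factorization \<sigma> a l xs ys})"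

definition U_WFFR :: "('a::comm_ring_1 \<times> 'a) set \<Rightarrow> assoc_kind \<Rightarrow> bool" where
  "U_WFFR \<sigma> \<beta> \<longleftrightarrow>
     (\<forall>a. \<not> a dvd 1 \<longrightarrow> finite_up_to (assoc_by \<beta>) {b. essential_divisor \<sigma> b a})"

definition U_df_ring :: "('a::comm_ring_1 \<times> 'a) set \<Rightarrow> atom_kind \<Rightarrow> assoc_kind \<Rightarrow> bool" where
  "U_df_ring \<sigma> \<alpha> \<beta> \<longleftrightarrow>
     (\<forall>a. \<not> a dvd 1 \<longrightarrow>
        finite_up_to (assoc_by \<beta>) {b. essential_divisor \<sigma> b a \<and> atom \<sigma> \<alpha> b})"


section \<open>Regular notions\<close>

definition reg_factorization :: "('a::comm_ring_1 \<times> 'a) set \<Rightarrow> 'a \<Rightarrow> 'a \<Rightarrow> 'a list \<Rightarrow> bool" where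
  "reg_factorization \<tau> a l xs \<longleftrightarrow> a \<in> Reg \<and> factorization \<tau> a l xs"

definition r_irreducible :: "('a::comm_ring_1 \<times> 'a) set \<Rightarrow> 'a \<Rightarrow> bool" where
  "r_irreducible \<tau> a \<longleftrightarrow>
     a \<in> Reg_nonunits \<and>
     (\<forall>l xs. reg_factorization \<tau> a l xs \<longrightarrow> (\<exists>x\<in>set xs. associate a x))"

definition r_atomic_factorization ::
  "('a::comm_ring_1 \<times> 'a) set \<Rightarrow> 'a \<Rightarrow> 'a \<Rightarrow> 'a list \<Rightarrow> bool" where
  "r_atomic_factorization \<tau> a l xs \<longleftrightarrow>
     reg_factorization \<tau> a l xs \<and> (\<forall>x\<in>set xs. r_irreducible \<tau> x)"

definition regular_atomic :: "('a::comm_ring_1 \<times> 'a) set \<Rightarrow> bool" where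
  "regular_atomic \<tau> \<longleftrightarrow> (\<forall>a\<in>Reg_nonunits. \<exists>l xs. r_atomic_factorization \<tau> a l xs)"

definition regular_ACCP :: "('a::comm_ring_1 \<times> 'a) set \<Rightarrow> bool" where
  "regular_ACCP \<tau> \<longleftrightarrow>
     \<not> (\<exists>a :: nat \<Rightarrow> 'a.
          \<forall>i. a i \<in> Reg \<and> pideal (a i) \<subset> pideal (a (Suc i)) \<and>
              (\<exists>l xs. reg_factorization \<tau> (a i) l xs \<and> a (Suc i) \<in> set xs))"

definition regular_HFR :: "('a::comm_ring_1 \<times> 'a) set \<Rightarrow> bool" where
  "regular_HFR \<tau> \<longleftrightarrow>
     regular_atomic \<tau> \<and>
     (\<forall>a l xs l' xs'.
        r_atomic_factorization \<tau> a l xs \<longrightarrow> r_atomic_factorization \<tau> a l' xs' \<longrightarrow>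
        length xs = length xs')"

definition regular_UFR :: "('a::comm_ring_1 \<times> 'a) set \<Rightarrow> bool" where
  "regular_UFR \<tau> \<longleftrightarrow>
     regular_HFR \<tau> \<and>
     (\<forall>a l xs l' xs'.
        r_atomic_factorization \<tau> a l xs \<longrightarrow> r_atomic_factorization \<tau> a l' xs' \<longrightarrow>
        rel_mset associate (mset xs) (mset xs'))"

definition regular_BFR :: "('a::comm_ring_1 \<times> 'a) set \<Rightarrow> bool" where
  "regular_BFR \<tau> \<longleftrightarrow>
     (\<forall>a\<in>Reg. \<exists>N::nat. \<forall>l xs. reg_factorization \<tau> a l xs \<longrightarrow> length xs \<le> N)"

definition regular_idf :: "('a::comm_ring_1 \<times> 'a) set \<Rightarrow> bool" where
  "regular_idf \<tau> \<longleftrightarrow>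
     (\<forall>a\<in>Reg_nonunits. finite_up_to associate {b. sdivisor \<tau> b a \<and> r_irreducible \<tau> b})"

definition regular_WFFR :: "('a::comm_ring_1 \<times> 'a) set \<Rightarrow> bool" where
  "regular_WFFR \<tau> \<longleftrightarrow>
     (\<forall>a\<in>Reg_nonunits. finite_up_to associate {b. sdivisor \<tau> b a})"

definition regular_FFR :: "('a::comm_ring_1 \<times> 'a) set \<Rightarrow> bool" where
  "regular_FFR \<tau> \<longleftrightarrow>
     (\<forall>a\<in>Reg_nonunits.
        finite_up_to (same_factorization associate) {(l, xs). factorization \<tau> a l xs})"

end

theory Submission
  imports Defs Complex_Main
begin

text \<open>
  Let \<open>\<sigma> = tau_reg \<tau>\<close>. Everything rests on three observations about \<open>\<sigma>\<close>-factorizations.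

  \<^item> In a \<open>\<sigma>\<close>-factorization of length at least two every factor is related to another one and
    hence regular, so the product is regular. A non-regular non-unit \<open>a\<close> therefore has only the
    trivial factorizations \<open>a = \<lambda> x\<close>, whose factors are all strongly associate to \<open>a\<close>
    (\<open>factorization_tau_reg_nontrivial\<close>). Such an element is an atom in every sense and satisfies
    every uniqueness and finiteness condition, so it never matters.

  \<^item> All divisors of a regular element are regular. For such an element \<open>\<sigma>\<close>-factorizations and
    \<open>\<tau>\<close>-factorizations agree, and cancellation makes associates strongly associate and forces a
    factorization containing an associate of the element to be trivial. So the two choices of
    \<open>\<beta>\<close> coincide and the four notions of atom all become \<open>r_irreducible\<close>
    (\<open>factorization_tau_reg_iff\<close>, \<open>assoc_by_Reg\<close>, \<open>atom_tau_reg_iff\<close>).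

  \<^item> An inessential divisor \<open>x\<close> satisfies \<open>x (p) = (p)\<close> with \<open>p\<close> the product of the essential ones. It is
    paired with each of these, so \<open>p\<close> is regular and \<open>x\<close> would be a unit. Hence
    there are no inessential divisors, and by the same cancellation every factor of a
    \<open>\<sigma>\<close>-factorization is essential (\<open>sU_factorization_tau_reg_iff\<close>).

  This reduces each property to its regular version, apart from the chain conditions, where weakly
  ascending chains must be thinned out to strictly ascending ones (\<open>ACCP_iff\<close>).

  Let now \<open>\<tau>\<close> be refinable, so that being a \<open>\<tau>\<close>-divisor is transitive. If each regular non-unit
  has finitely many divisor classes, then their number strictly decreases along proper
  \<open>\<tau>\<close>-divisors, and induction on it yields atomic factorizations. Conversely, let the ring
  be regular-atomic with finitely many irreducible divisors of each element up to associates. Two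
  atomic factorizations of a regular element cannot have comparable exponent vectors, since
  cancelling would write a unit as a nonempty product of non-units; by Dickson's lemma the lengths of
  atomic factorizations are then bounded (\<open>bounded_length_over_finite_set\<close>). Every
  \<open>\<tau>\<close>-factorization arises from an atomic one by grouping factors, which leaves only finitely many.
\<close>

section \<open>Finiteness up to an equivalence relation\<close>

lemma quotient_Collect: "S // {(x, y). r x y} = (\<lambda>x. {y. r x y}) ` S"
  by (auto simp: quotient_def)

text \<open>
  Equivalence classes are taken in the whole type, but the class of \<open>x\<close> depends on \<open>r\<close> only through
  \<open>r x\<close>. So the relations have to agree only at left arguments in \<open>S\<close>; later these are the regular elements.
\<close>

lemma finite_up_to_cong:
  assumes "\<And>x y. x \<in> S \<Longrightarrow> r x y \<longleftrightarrow> r' x y"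
  shows "finite_up_to r S \<longleftrightarrow> finite_up_to r' S"
proof -
  have "(\<lambda>x. {y. r x y}) ` S = (\<lambda>x. {y. r' x y}) ` S"
    using assms by (intro image_cong) auto
  then show ?thesis by (simp add: finite_up_to_def quotient_Collect)
qed

lemma finite_up_to_empty: "finite_up_to r {}"
  by (simp add: finite_up_to_def)

lemma finite_up_to_Un: "finite_up_to r (S \<union> S') \<longleftrightarrow> finite_up_to r S \<and> finite_up_to r S'"
  by (simp add: finite_up_to_def quotient_Collect image_Un)

lemma finite_up_to_subset: "finite_up_to r S \<Longrightarrow> S' \<subseteq> S \<Longrightarrow> finite_up_to r S'"
  using finite_up_to_Un[of r S' S] by (simp add: Un_absorb1)

lemma finite_up_toI_cover:
  assumes "equivp r" and "finite T" and "\<And>x. x \<in> S \<Longrightarrow> \<exists>t\<in>T. r x t"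
  shows "finite_up_to r S"
proof -
  have "(\<lambda>x. {y. r x y}) ` S \<subseteq> (\<lambda>x. {y. r x y}) ` T"
  proof clarify
    fix x assume "x \<in> S"
    then obtain t where "t \<in> T" "r x t" using assms(3) by blast
    then have "{y. r x y} = {y. r t y}"
      using assms(1) by (auto simp: equivp_def)
    then show "{y. r x y} \<in> (\<lambda>x. {y. r x y}) ` T" using \<open>t \<in> T\<close> by blast
  qed
  then show ?thesis
    unfolding finite_up_to_def quotient_Collect using assms(2) finite_subset finite_imageI by blast
qed

lemma finite_up_to_cover:
  assumes "equivp r" and "finite_up_to r S"
  shows "\<exists>T. finite T \<and> T \<subseteq> S \<and> (\<forall>x\<in>S. \<exists>t\<in>T. r x t)"
proof -
  let ?cls = "\<lambda>x. {y. r x y}"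
  have "finite (?cls ` S)"
    using assms(2) by (simp add: finite_up_to_def quotient_Collect)
  from finite_subset_image[OF this subset_refl]
  obtain T where T: "T \<subseteq> S" "finite T" "?cls ` S = ?cls ` T" by auto
  have "\<exists>t\<in>T. r x t" if "x \<in> S" for x
  proof -
    have "?cls x \<in> ?cls ` T" unfolding T(3)[symmetric] using that by (rule imageI)
    then obtain t where t: "t \<in> T" "?cls x = ?cls t" by (rule imageE)
    have "t \<in> ?cls t" using equivp_reflp[OF assms(1)] by simp
    then have "r x t" unfolding t(2)[symmetric] by simp
    then show ?thesis using t(1) by blast
  qed
  then show ?thesis using T(1,2) by blast
qed

lemma finite_up_to_single_class:
  assumes "equivp r" and "\<And>x. x \<in> S \<Longrightarrow> r x c"
  shows "finite_up_to r S"
  by (rule finite_up_toI_cover[OF assms(1), of "{c}"]) (use assms(2) in auto)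

lemma finite_up_to_image:
  assumes "equivp r" and "equivp r'" and "\<And>x y. r (f x) (f y) \<longleftrightarrow> r' x y"
  shows "finite_up_to r (f ` S) \<longleftrightarrow> finite_up_to r' S"
proof
  assume "finite_up_to r (f ` S)"
  from finite_up_to_cover[OF assms(1) this]
  obtain T where T: "finite T" "T \<subseteq> f ` S" "\<forall>x\<in>f ` S. \<exists>t\<in>T. r x t" by blast
  obtain T' where T': "T' \<subseteq> S" "finite T'" "T = f ` T'" using finite_subset_image[OF T(1,2)] by auto
  show "finite_up_to r' S"
  proof (rule finite_up_toI_cover[OF assms(2) T'(2)])
    fix x assume "x \<in> S"
    then have "\<exists>t\<in>f ` T'. r (f x) t" using T(3) T'(3) by simp
    then show "\<exists>t\<in>T'. r' x t" by (simp add: assms(3))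
  qed
next
  assume "finite_up_to r' S"
  from finite_up_to_cover[OF assms(2) this]
  obtain T where T: "finite T" "T \<subseteq> S" "\<forall>x\<in>S. \<exists>t\<in>T. r' x t" by blast
  show "finite_up_to r (f ` S)"
  proof (rule finite_up_toI_cover[OF assms(1) finite_imageI[OF T(1)]])
    fix y assume "y \<in> f ` S"
    then obtain x where "x \<in> S" "y = f x" by (rule imageE)
    then show "\<exists>t\<in>f ` T. r y t" using T(3) by (simp add: assms(3))
  qed
qed

lemma equivp_rel_mset: "equivp r \<Longrightarrow> equivp (rel_mset r)"
  by (simp add: equivp_reflp_symp_transp multiset.rel_reflp multiset.rel_symp multiset.rel_transp)

lemma equivp_pullback: "equivp r \<Longrightarrow> equivp (\<lambda>x y. r (f x) (f y))"
  unfolding equivp_reflp_symp_transp reflp_def symp_def transp_def by blast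

lemma equivp_same_factorization:
  assumes "equivp r"
  shows "equivp (same_factorization r)"
proof -
  have "same_factorization r = (\<lambda>x y. rel_mset r (mset (snd x)) (mset (snd y)))"
    by (auto simp: same_factorization_def fun_eq_iff)
  then show ?thesis by (simp only:) (rule equivp_pullback[OF equivp_rel_mset[OF assms]])
qed

lemma equivp_same_U_factorization:
  assumes "equivp r"
  shows "equivp (same_U_factorization r)"
proof -
  have "same_U_factorization r = (\<lambda>x y. rel_mset r (mset (snd (snd x))) (mset (snd (snd y))))"
    by (auto simp: same_U_factorization_def fun_eq_iff)
  then show ?thesis by (simp only:) (rule equivp_pullback[OF equivp_rel_mset[OF assms]])
qed

lemma list_all2_imp_rel_mset: "list_all2 r xs ys \<Longrightarrow> rel_mset r (mset xs) (mset ys)"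
  unfolding rel_mset_def by blast

text \<open>
  As in \<open>finite_up_to_cong\<close>, control over the left argument suffices: regularity is known for the
  factors of one factorization, while the other multiset is arbitrary.
\<close>

lemma rel_mset_cong_left:
  assumes "\<And>x y. x \<in># M \<Longrightarrow> r x y \<longleftrightarrow> r' x y"
  shows "rel_mset r M N \<longleftrightarrow> rel_mset r' M N"
  by (intro multiset.rel_cong refl assms)

section \<open>Regular elements and associates\<close>

lemma pideal_subset_iff: "pideal a \<subseteq> pideal b \<longleftrightarrow> b dvd a"
proof
  assume "pideal a \<subseteq> pideal b"
  moreover have "a \<in> pideal a" unfolding pideal_def by (auto intro: exI[of _ 1])
  ultimately show "b dvd a" unfolding pideal_def by auto
next
  assume "b dvd a"
  then show "pideal a \<subseteq> pideal b"
    unfolding pideal_def dvd_def by clarsimp (metis mult.assoc mult.commute)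
qed

lemma associate_iff_dvd: "associate a b \<longleftrightarrow> a dvd b \<and> b dvd a"
  unfolding associate_def using pideal_subset_iff by blast

lemma image_mult_pideal: "(*) (x :: 'a::comm_ring_1) ` pideal p = pideal (x * p)"
proof -
  have "pideal q = range (\<lambda>r. r * q)" for q :: 'a unfolding pideal_def by auto
  then show ?thesis by (simp add: image_image mult.left_commute)
qed

lemma strongly_associate_imp_associate:
  assumes "strongly_associate a b"
  shows "associate a b"
proof -
  obtain u v where uv: "u * v = 1" "a = u * b"
    using assms unfolding strongly_associate_def by (metis dvdE)
  have "v * a = u * v * b" by (simp add: uv(2) ac_simps)
  then have "v * a = b" by (simp add: uv(1))
  then have "a dvd b" using dvd_triv_right by metis
  then show ?thesis by (simp add: uv(2) associate_iff_dvd)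
qed

lemma equivp_associate: "equivp associate"
  by (rule equivpI) (auto simp: associate_def reflp_def symp_def transp_def)

lemma equivp_strongly_associate: "equivp (strongly_associate :: 'a::comm_ring_1 \<Rightarrow> _)"
proof (rule equivpI)
  show "reflp (strongly_associate :: 'a \<Rightarrow> _)"
    unfolding reflp_def strongly_associate_def by (metis dvd_refl mult_1)
  show "symp (strongly_associate :: 'a \<Rightarrow> _)"
    unfolding symp_def strongly_associate_def
    by (metis dvd_def dvd_triv_right mult.commute mult.left_commute mult_1)
  show "transp (strongly_associate :: 'a \<Rightarrow> _)"
    unfolding transp_def strongly_associate_def by (metis mult.assoc mult_dvd_mono mult_1)
qed

lemma equivp_assoc_by: "equivp (assoc_by \<beta>)"
proof (cases \<beta>)
  case Associate
  then have "assoc_by \<beta> = associate" by (intro ext) simp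
  then show ?thesis using equivp_associate by metis
next
  case Strongly_Associate
  then have "assoc_by \<beta> = strongly_associate" by (intro ext) simp
  then show ?thesis using equivp_strongly_associate by metis
qed

lemma strongly_associate_imp_assoc_by: "strongly_associate a b \<Longrightarrow> assoc_by \<beta> a b"
  by (cases \<beta>) (auto simp: strongly_associate_imp_associate)

lemma Reg_cancel: "a \<in> Reg \<Longrightarrow> a * x = 0 \<Longrightarrow> x = 0"
  unfolding Reg_def by blast

lemma RegI: "(\<And>x. a * x = 0 \<Longrightarrow> x = 0) \<Longrightarrow> a \<in> Reg"
  unfolding Reg_def by blast

lemma Reg_mult_iff: "a * b \<in> Reg \<longleftrightarrow> a \<in> Reg \<and> b \<in> Reg"
proof
  assume ab: "a * b \<in> Reg"
  have "a \<in> Reg"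
  proof (rule RegI)
    fix x assume "a * x = 0"
    moreover have "a * b * x = b * (a * x)" by (simp only: ac_simps)
    ultimately have "a * b * x = 0" by simp
    with ab show "x = 0" by (rule Reg_cancel)
  qed
  moreover have "b \<in> Reg"
  proof (rule RegI)
    fix x assume "b * x = 0"
    then have "a * b * x = 0" by (simp add: mult.assoc)
    with ab show "x = 0" by (rule Reg_cancel)
  qed
  ultimately show "a \<in> Reg \<and> b \<in> Reg" ..
next
  assume ab: "a \<in> Reg \<and> b \<in> Reg"
  show "a * b \<in> Reg"
  proof (rule RegI)
    fix x assume "a * b * x = 0"
    then have "a * (b * x) = 0" by (simp add: mult.assoc)
    then show "x = 0" using ab Reg_cancel by blast
  qed
qed

lemma one_in_Reg: "1 \<in> Reg"
  by (simp add: Reg_def)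

lemma Reg_dvd: "b \<in> Reg \<Longrightarrow> a dvd b \<Longrightarrow> a \<in> Reg"
  by (auto simp: Reg_mult_iff dvd_def)

lemma unit_in_Reg: "u dvd 1 \<Longrightarrow> u \<in> Reg"
  using Reg_dvd one_in_Reg by blast

lemma prod_list_in_Reg_iff: "prod_list xs \<in> Reg \<longleftrightarrow> set xs \<subseteq> Reg"
  by (induction xs) (auto simp: one_in_Reg Reg_mult_iff)

lemma prod_in_Reg: "(\<And>i. i \<in> I \<Longrightarrow> f i \<in> Reg) \<Longrightarrow> prod f I \<in> Reg"
  by (induction I rule: infinite_finite_induct) (auto simp: one_in_Reg Reg_mult_iff)

lemma Reg_cancel_unit:
  assumes "a \<in> Reg" and "a * b dvd a"
  shows "b dvd 1"
proof -
  obtain c where "a = a * b * c" using assms(2) by (auto simp: dvd_def)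
  then have "a * (1 - b * c) = 0" by (simp add: algebra_simps)
  then have "1 - b * c = 0" using assms(1) Reg_cancel by blast
  then have "b * c = 1" by simp
  then show ?thesis using dvd_triv_left[of b c] by simp
qed

lemma associate_Reg_imp_strongly_associate:
  assumes "a \<in> Reg" and "associate a b"
  shows "strongly_associate a b"
proof -
  obtain u where u: "a = b * u" using assms(2) by (auto simp: associate_iff_dvd)
  have "b \<in> Reg" using assms u by (auto simp: Reg_mult_iff)
  moreover have "b * u dvd b" using assms(2) u by (auto simp: associate_iff_dvd)
  ultimately have "u dvd 1" by (rule Reg_cancel_unit)
  then show ?thesis using u unfolding strongly_associate_def by (auto simp: mult.commute)
qed

lemma assoc_by_Reg: "a \<in> Reg \<Longrightarrow> assoc_by \<beta> a b \<longleftrightarrow> associate a b"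
  by (cases \<beta>)
    (auto intro: associate_Reg_imp_strongly_associate strongly_associate_imp_associate)

section \<open>Factorizations of regular and of non-regular elements\<close>

lemma factorization_singleton_iff:
  "factorization \<sigma> a l [x] \<longleftrightarrow> \<not> a dvd 1 \<and> \<not> x dvd 1 \<and> l dvd 1 \<and> a = l * x"
  unfolding factorization_def by auto

lemma factorization_self: "\<not> a dvd 1 \<Longrightarrow> factorization \<sigma> a 1 [a]"
  by (simp add: factorization_singleton_iff)

lemma factorization_length_1E:
  assumes "factorization \<sigma> a l xs" and "length xs = 1"
  obtains x where "xs = [x]" "strongly_associate a x"
  using assms by (cases xs) (auto simp: factorization_singleton_iff strongly_associate_def)

lemma factor_dvd:
  assumes "factorization \<sigma> a l xs" and "x \<in> set xs"
  shows "x dvd a"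
  using assms unfolding factorization_def by (auto intro: dvd_mult prod_list_dvd)

lemma factorization_set_Reg_nonunits:
  assumes "factorization \<sigma> a l xs" and "a \<in> Reg"
  shows "set xs \<subseteq> Reg_nonunits"
  using assms factor_dvd[OF assms(1)] Reg_dvd[OF assms(2)]
  by (auto simp: Reg_nonunits_def factorization_def)

text \<open>
  If \<open>a = \<lambda> x c\<close> is associate to its factor \<open>x\<close>, then \<open>x\<close> can be cancelled, and the product \<open>c\<close> of the
  other factors is a unit. As those factors are non-units, there are none.
\<close>

lemma regular_factorization_trivial:
  assumes "factorization \<sigma> a l xs" and "a \<in> Reg" and "x \<in> set xs" and "associate a x"
  shows "xs = [x]"
proof -
  obtain ps qs where xs: "xs = ps @ x # qs" using split_list[OF assms(3)] by blast
  have a: "a = x * (l * prod_list (ps @ qs))"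
    using assms(1) xs by (simp add: factorization_def algebra_simps)
  have "x \<in> Reg" using assms(2) a by (simp add: Reg_mult_iff)
  moreover have "x * (l * prod_list (ps @ qs)) dvd x"
    using assms(4) a by (simp add: associate_iff_dvd)
  ultimately have "l * prod_list (ps @ qs) dvd 1" by (rule Reg_cancel_unit)
  then have "prod_list (ps @ qs) dvd 1" using dvd_mult_right by blast
  then have "y dvd 1" if "y \<in> set (ps @ qs)" for y
    using prod_list_dvd[OF that] dvd_trans by blast
  moreover have "\<not> y dvd 1" if "y \<in> set (ps @ qs)" for y
    using assms(1) xs that by (auto simp: factorization_def)
  ultimately have "set (ps @ qs) = {}" by (meson ex_in_conv)
  then show ?thesis using xs by simp
qed

lemma factorization_tau_reg_nth_Reg:
  assumes "factorization (tau_reg \<tau>) a l xs" and "i < length xs" "j < length xs" "i \<noteq> j"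
  shows "xs ! i \<in> Reg"
  using assms unfolding factorization_def tau_reg_def by blast

text \<open>
  With at least two factors, each index has a partner, and membership in \<open>tau_reg \<tau>\<close> makes the
  factor at that index regular.
\<close>

lemma factorization_tau_reg_nontrivial:
  assumes "factorization (tau_reg \<tau>) a l xs" and "length xs \<noteq> 1"
  shows "a \<in> Reg"
proof -
  have len: "length xs \<ge> 2" using assms by (auto simp: factorization_def)
  have "x \<in> Reg" if "x \<in> set xs" for x
  proof -
    obtain i where i: "i < length xs" "x = xs ! i" using \<open>x \<in> set xs\<close> by (auto simp: in_set_conv_nth)
    have "\<exists>j<length xs. i \<noteq> j"
      using len by (intro exI[of _ "if i = 0 then 1 else 0"]) auto
    then show ?thesis using factorization_tau_reg_nth_Reg[OF assms(1) i(1)] i(2) by blast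
  qed
  then show ?thesis
    using assms(1) by (auto simp: factorization_def Reg_mult_iff prod_list_in_Reg_iff unit_in_Reg)
qed

lemma factorization_tau_reg_iff:
  assumes "a \<in> Reg"
  shows "factorization (tau_reg \<tau>) a l xs \<longleftrightarrow> factorization \<tau> a l xs"
proof
  assume "factorization (tau_reg \<tau>) a l xs"
  then show "factorization \<tau> a l xs" unfolding factorization_def tau_reg_def by blast
next
  assume f: "factorization \<tau> a l xs"
  then have "xs ! i \<in> Reg" if "i < length xs" for i
    using factorization_set_Reg_nonunits[OF f assms] nth_mem[OF that] by (auto simp: Reg_nonunits_def)
  with f show "factorization (tau_reg \<tau>) a l xs"
    unfolding factorization_def tau_reg_def by blast
qed

lemma sdivisor_tau_reg_iff: "a \<in> Reg \<Longrightarrow> sdivisor (tau_reg \<tau>) b a \<longleftrightarrow> sdivisor \<tau> b a"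
  by (simp add: sdivisor_def factorization_tau_reg_iff)

lemma sdivisor_tau_reg_nonregular:
  assumes "a \<notin> Reg" and "sdivisor (tau_reg \<tau>) b a"
  shows "strongly_associate a b"
proof -
  obtain l xs where f: "factorization (tau_reg \<tau>) a l xs" "b \<in> set xs"
    using assms(2) by (auto simp: sdivisor_def)
  then have "length xs = 1" using factorization_tau_reg_nontrivial assms(1) by blast
  with f show ?thesis by (auto elim!: factorization_length_1E)
qed

lemma sdivisor_self: "\<not> a dvd 1 \<Longrightarrow> sdivisor \<sigma> a a"
  unfolding sdivisor_def using factorization_self by fastforce

lemma sdivisor_dvd: "sdivisor \<sigma> b a \<Longrightarrow> b dvd a"
  unfolding sdivisor_def using factor_dvd by blast

lemma sdivisor_nonunits: "sdivisor \<sigma> b a \<Longrightarrow> \<not> a dvd 1 \<and> \<not> b dvd 1"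
  unfolding sdivisor_def factorization_def by blast

text \<open>
  The four kinds of atom collapse because a factorization contains an associate of \<open>a\<close> exactly when
  it is trivial: by cancellation if \<open>a\<close> is regular, and because there are only trivial
  factorizations otherwise.
\<close>

lemma atom_tau_reg_iff:
  "atom (tau_reg \<tau>) \<alpha> a \<longleftrightarrow> \<not> a dvd 1 \<and> (a \<in> Reg \<longrightarrow> r_irreducible \<tau> a)"
proof (cases "a dvd 1")
  case True
  then show ?thesis by (cases \<alpha>) auto
next
  case nonunit: False
  let ?f = "factorization (tau_reg \<tau>) a"
  have len1: "length xs = 1" if "?f l xs" "x \<in> set xs" "associate a x" for l xs x
  proof (cases "a \<in> Reg")
    case True
    then have "xs = [x]" using regular_factorization_trivial that by blast
    then show ?thesis by simp
  next
    case False
    then show ?thesis using factorization_tau_reg_nontrivial that(1) by blast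
  qed
  have strong: "\<forall>x\<in>set xs. strongly_associate a x" if "?f l xs" "length xs = 1" for l xs
    using that by (auto elim!: factorization_length_1E)
  have nonempty: "hd xs \<in> set xs" if "?f l xs" for l xs
    using that by (cases xs) (auto simp: factorization_def)
  have iff1: "(\<exists>x\<in>set xs. associate a x) \<longleftrightarrow> length xs = 1" if "?f l xs" for l xs
    using len1[OF that] strong[OF that] nonempty[OF that] strongly_associate_imp_associate by blast
  have iff2: "(\<exists>x\<in>set xs. strongly_associate a x) \<longleftrightarrow> length xs = 1" if "?f l xs" for l xs
    using len1[OF that] strong[OF that] nonempty[OF that] strongly_associate_imp_associate by blast
  have iff3: "(\<forall>x\<in>set xs. associate a x) \<longleftrightarrow> length xs = 1" if "?f l xs" for l xs
    using len1[OF that] strong[OF that] nonempty[OF that] strongly_associate_imp_associate by blast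
  have unrefinable: "atom (tau_reg \<tau>) \<alpha> a \<longleftrightarrow> (\<forall>l xs. ?f l xs \<longrightarrow> length xs = 1)"
    using nonunit by (cases \<alpha>) (simp_all add: iff1 iff2 iff3)
  show ?thesis
  proof (cases "a \<in> Reg")
    case True
    then show ?thesis
      using nonunit iff1
      by (simp add: unrefinable r_irreducible_def Reg_nonunits_def reg_factorization_def
          factorization_tau_reg_iff)
  next
    case False
    then show ?thesis
      using nonunit factorization_tau_reg_nontrivial unrefinable by blast
  qed
qed

text \<open>
  Only products of factors at indices that have a partner get cancelled, and these are regular. In
  the converse direction the product of all factors except \<open>y\<^sub>j\<close> is of this kind even when there is a single
  factor and the product is the empty one, which is how trivial factorizations of non-regular elements are
  covered.
\<close>

lemma sU_factorization_tau_reg_iff: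
  "sU_factorization (tau_reg \<tau>) a l xs ys \<longleftrightarrow> xs = [] \<and> factorization (tau_reg \<tau>) a l ys"
proof
  assume U: "sU_factorization (tau_reg \<tau>) a l xs ys"
  then have f: "factorization (tau_reg \<tau>) a l (xs @ ys)" by (simp add: sU_factorization_def)
  have "xs = []"
  proof (rule ccontr)
    assume "xs \<noteq> []"
    then have 0: "0 < length xs" and hd: "hd xs \<in> set xs" by auto
    have "ys ! j \<in> Reg" if "j < length ys" for j
      using factorization_tau_reg_nth_Reg[OF f, of "length xs + j" 0] 0 that by simp
    then have "prod_list ys \<in> Reg" by (auto simp: prod_list_in_Reg_iff in_set_conv_nth)
    moreover have "pideal (hd xs * prod_list ys) = pideal (prod_list ys)"
      using U hd by (simp add: sU_factorization_def U_factorization_def image_mult_pideal)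
    then have "prod_list ys * hd xs dvd prod_list ys"
      using associate_iff_dvd by (auto simp: associate_def mult.commute)
    ultimately have "hd xs dvd 1" by (rule Reg_cancel_unit)
    then show False using U hd by (auto simp: sU_factorization_def U_factorization_def)
  qed
  with f show "xs = [] \<and> factorization (tau_reg \<tau>) a l ys" by simp
next
  assume "xs = [] \<and> factorization (tau_reg \<tau>) a l ys"
  then have xs: "xs = []" and f: "factorization (tau_reg \<tau>) a l ys" by auto
  have "pideal (ys ! j * (\<Prod>k\<in>{..<length ys} - {j}. ys ! k)) \<noteq>
      pideal (\<Prod>k\<in>{..<length ys} - {j}. ys ! k)" (is "pideal (_ * ?q) \<noteq> _") if j: "j < length ys" for j
  proof
    assume "pideal (ys ! j * ?q) = pideal ?q"
    then have "?q * ys ! j dvd ?q"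
      using associate_iff_dvd by (auto simp: associate_def mult.commute)
    moreover have "?q \<in> Reg"
      by (rule prod_in_Reg) (use factorization_tau_reg_nth_Reg[OF f] j in auto)
    ultimately have "ys ! j dvd 1" by (rule Reg_cancel_unit[rotated])
    then show False using f j by (auto simp: factorization_def)
  qed
  then show "sU_factorization (tau_reg \<tau>) a l xs ys"
    using f xs by (auto simp: sU_factorization_def U_factorization_def image_mult_pideal factorization_def)
qed

section \<open>U-notions coincide with the plain ones\<close>

lemma essential_divisor_tau_reg_iff:
  "essential_divisor (tau_reg \<tau>) b a \<longleftrightarrow> sdivisor (tau_reg \<tau>) b a"
  by (simp add: essential_divisor_def sdivisor_def sU_factorization_tau_reg_iff)

lemma U_atom_factorization_tau_reg_iff:
  "U_atom_factorization (tau_reg \<tau>) \<alpha> a l xs ys \<longleftrightarrow>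
     xs = [] \<and> atom_factorization (tau_reg \<tau>) \<alpha> a l ys"
  by (auto simp: U_atom_factorization_def atom_factorization_def sU_factorization_tau_reg_iff)

lemma U_alpha_ring_iff: "U_alpha_ring (tau_reg \<tau>) \<alpha> \<longleftrightarrow> alpha_ring (tau_reg \<tau>) \<alpha>"
  by (simp add: U_alpha_ring_def alpha_ring_def U_atom_factorization_tau_reg_iff)

lemma U_HFR_iff: "U_HFR (tau_reg \<tau>) \<alpha> \<longleftrightarrow> HFR (tau_reg \<tau>) \<alpha>"
  by (simp add: U_HFR_def HFR_def U_alpha_ring_iff U_atom_factorization_tau_reg_iff)

lemma U_UFR_iff: "U_UFR (tau_reg \<tau>) \<alpha> \<beta> \<longleftrightarrow> UFR (tau_reg \<tau>) \<alpha> \<beta>"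
  by (simp add: U_UFR_def UFR_def U_HFR_iff U_atom_factorization_tau_reg_iff)

lemma U_BFR_iff: "U_BFR (tau_reg \<tau>) \<longleftrightarrow> BFR (tau_reg \<tau>)"
  by (simp add: U_BFR_def BFR_def sU_factorization_tau_reg_iff)

lemma U_df_ring_iff: "U_df_ring (tau_reg \<tau>) \<alpha> \<beta> \<longleftrightarrow> df_ring (tau_reg \<tau>) \<alpha> \<beta>"
  by (simp add: U_df_ring_def df_ring_def essential_divisor_tau_reg_iff)

text \<open>
  Essential divisors include those of trivial factorizations, which \<open>WFFR\<close> excludes; the latter
  contribute the single class of \<open>a\<close> itself.
\<close>

lemma U_WFFR_iff: "U_WFFR (tau_reg \<tau>) \<beta> \<longleftrightarrow> WFFR (tau_reg \<tau>) \<beta>"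
proof -
  have "finite_up_to (assoc_by \<beta>) {b. essential_divisor (tau_reg \<tau>) b a} \<longleftrightarrow>
      finite_up_to (assoc_by \<beta>) {b. nontrivial_sdivisor (tau_reg \<tau>) b a}" for a
  proof -
    have "{b. essential_divisor (tau_reg \<tau>) b a} =
        {b. nontrivial_sdivisor (tau_reg \<tau>) b a} \<union>
        {b. \<exists>l. factorization (tau_reg \<tau>) a l [b]}"
      (is "?E = ?N \<union> ?T")
    proof (intro set_eqI iffI)
      fix b assume "b \<in> ?E"
      then obtain l xs where f: "factorization (tau_reg \<tau>) a l xs" "b \<in> set xs"
        by (auto simp: essential_divisor_tau_reg_iff sdivisor_def)
      show "b \<in> ?N \<union> ?T"
      proof (cases "length xs = 1")
        case True
        then have "xs = [b]" using f by (auto elim: factorization_length_1E)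
        then show ?thesis using f by blast
      next
        case False
        then show ?thesis using f unfolding nontrivial_sdivisor_def by blast
      qed
    next
      fix b assume "b \<in> ?N \<union> ?T"
      moreover have "b \<in> set [b]" by simp
      ultimately show "b \<in> ?E"
        unfolding essential_divisor_tau_reg_iff sdivisor_def nontrivial_sdivisor_def by blast
    qed
    moreover have "finite_up_to (assoc_by \<beta>) {b. \<exists>l. factorization (tau_reg \<tau>) a l [b]}"
    proof (rule finite_up_to_single_class[OF equivp_assoc_by, of _ _ a])
      fix b assume "b \<in> {b. \<exists>l. factorization (tau_reg \<tau>) a l [b]}"
      then have "strongly_associate a b"
        by (auto simp: factorization_singleton_iff strongly_associate_def)
      then show "assoc_by \<beta> b a"
        using strongly_associate_imp_assoc_by equivp_symp[OF equivp_assoc_by] by blast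
    qed
    ultimately show ?thesis by (simp add: finite_up_to_Un)
  qed
  then show ?thesis by (simp add: U_WFFR_def WFFR_def)
qed

lemma finite_up_to_nontrivial_factorizations_iff:
  "finite_up_to (same_factorization (assoc_by \<beta>)) {(l, xs). factorization \<sigma> a l xs \<and> length xs \<noteq> 1}
   \<longleftrightarrow> finite_up_to (same_factorization (assoc_by \<beta>)) {(l, xs). factorization \<sigma> a l xs}"
proof -
  have "{(l, xs). factorization \<sigma> a l xs} =
      {(l, xs). factorization \<sigma> a l xs \<and> length xs \<noteq> 1} \<union>
      {(l, xs). factorization \<sigma> a l xs \<and> length xs = 1}"
    by auto
  moreover have "finite_up_to (same_factorization (assoc_by \<beta>))
      {(l, xs). factorization \<sigma> a l xs \<and> length xs = 1}"
  proof (rule finite_up_to_single_class[of _ _ "(1, [a])"])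
    show "equivp (same_factorization (assoc_by \<beta>))"
      by (intro equivp_same_factorization equivp_assoc_by)
    fix p assume "p \<in> {(l, xs). factorization \<sigma> a l xs \<and> length xs = 1}"
    then obtain l x where p: "p = (l, [x])" "strongly_associate a x"
      by (auto elim: factorization_length_1E)
    then have "assoc_by \<beta> x a"
      using strongly_associate_imp_assoc_by equivp_symp[OF equivp_assoc_by] by blast
    then have "rel_mset (assoc_by \<beta>) (mset [x]) (mset [a])"
      by (intro list_all2_imp_rel_mset) simp
    then show "same_factorization (assoc_by \<beta>) p (1, [a])"
      using p by (simp add: same_factorization_def)
  qed
  ultimately show ?thesis by (simp add: finite_up_to_Un)
qed

lemma U_FFR_iff:
  fixes \<tau> :: "('a::comm_ring_1 \<times> 'a) set"
  shows "U_FFR (tau_reg \<tau>) \<beta> \<longleftrightarrow> FFR (tau_reg \<tau>) \<beta>"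
proof -
  have "finite_up_to (same_U_factorization (assoc_by \<beta>))
        {(l, xs, ys). sU_factorization (tau_reg \<tau>) a l xs ys} \<longleftrightarrow>
      finite_up_to (same_factorization (assoc_by \<beta>))
        {(l, ys). factorization (tau_reg \<tau>) a l ys}" for a
  proof -
    have "{(l, xs, ys). sU_factorization (tau_reg \<tau>) a l xs ys} =
        (\<lambda>(l, ys). (l, [], ys)) ` {(l, ys). factorization (tau_reg \<tau>) a l ys}"
      by (auto simp: sU_factorization_tau_reg_iff)
    moreover have "same_U_factorization (assoc_by \<beta>) (case p of (l, ys) \<Rightarrow> (l, [], ys))
          (case q of (l, ys) \<Rightarrow> (l, [], ys)) \<longleftrightarrow> same_factorization (assoc_by \<beta>) p q" for p q :: "'a \<times> 'a list"
      by (simp add: same_U_factorization_def same_factorization_def split: prod.split)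
    ultimately show ?thesis
      by (simp only:) (rule finite_up_to_image[OF equivp_same_U_factorization[OF equivp_assoc_by]
          equivp_same_factorization[OF equivp_assoc_by]])
  qed
  then show ?thesis unfolding U_FFR_def FFR_def finite_up_to_nontrivial_factorizations_iff by simp
qed

section \<open>Reduction to the regular elements\<close>

text \<open>
  The common pattern of the reductions: a condition on all non-units that holds automatically off the
  regular elements.
\<close>

lemma all_nonunits_iff_ball_Reg_nonunits:
  assumes "\<And>a. a \<notin> Reg \<Longrightarrow> P a" and "\<And>a. a \<in> Reg \<Longrightarrow> P a \<longleftrightarrow> Q a"
  shows "(\<forall>a. \<not> a dvd 1 \<longrightarrow> P a) \<longleftrightarrow> (\<forall>a\<in>Reg_nonunits. Q a)"
  using assms unfolding Reg_nonunits_def by blast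

lemma atom_factorization_tau_reg_iff:
  assumes "a \<in> Reg"
  shows "atom_factorization (tau_reg \<tau>) \<alpha> a l xs \<longleftrightarrow> r_atomic_factorization \<tau> a l xs"
proof -
  have "atom (tau_reg \<tau>) \<alpha> x \<longleftrightarrow> r_irreducible \<tau> x"
    if "factorization \<tau> a l xs" "x \<in> set xs" for x
    using factorization_set_Reg_nonunits[OF that(1) assms] that(2)
    by (auto simp: atom_tau_reg_iff Reg_nonunits_def)
  then show ?thesis using assms
    by (auto simp: atom_factorization_def r_atomic_factorization_def reg_factorization_def
        factorization_tau_reg_iff)
qed

lemma r_atomic_factorization_Reg_nonunits:
  "r_atomic_factorization \<tau> a l xs \<Longrightarrow> a \<in> Reg_nonunits"
  unfolding r_atomic_factorization_def reg_factorization_def factorization_def Reg_nonunits_def by blast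

lemma alpha_ring_iff: "alpha_ring (tau_reg \<tau>) \<alpha> \<longleftrightarrow> regular_atomic \<tau>"
proof -
  have "\<exists>l xs. atom_factorization (tau_reg \<tau>) \<alpha> a l xs" if "\<not> a dvd 1" "a \<notin> Reg" for a
  proof -
    have "atom_factorization (tau_reg \<tau>) \<alpha> a 1 [a]"
      using that by (simp add: atom_factorization_def factorization_self atom_tau_reg_iff)
    then show ?thesis by blast
  qed
  then show ?thesis
    unfolding alpha_ring_def regular_atomic_def Reg_nonunits_def
    using atom_factorization_tau_reg_iff by blast
qed

lemma HFR_iff: "HFR (tau_reg \<tau>) \<alpha> \<longleftrightarrow> regular_HFR \<tau>"
proof -
  have "length xs = 1" if "atom_factorization (tau_reg \<tau>) \<alpha> a l xs" "a \<notin> Reg" for a l xs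
    using that factorization_tau_reg_nontrivial by (auto simp: atom_factorization_def)
  then have "(\<forall>a l xs l' xs'. \<not> a dvd 1 \<longrightarrow>
        atom_factorization (tau_reg \<tau>) \<alpha> a l xs \<longrightarrow> atom_factorization (tau_reg \<tau>) \<alpha> a l' xs' \<longrightarrow>
        length xs = length xs') \<longleftrightarrow>
      (\<forall>a l xs l' xs'.
        r_atomic_factorization \<tau> a l xs \<longrightarrow> r_atomic_factorization \<tau> a l' xs' \<longrightarrow>
        length xs = length xs')"
    using atom_factorization_tau_reg_iff[of _ \<tau> \<alpha>] r_atomic_factorization_Reg_nonunits[of \<tau>]
    unfolding Reg_nonunits_def by (smt (verit) mem_Collect_eq)
  then show ?thesis by (simp add: HFR_def regular_HFR_def alpha_ring_iff)
qed

lemma UFR_iff: "UFR (tau_reg \<tau>) \<alpha> \<beta> \<longleftrightarrow> regular_UFR \<tau>"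
proof -
  let ?same = "\<lambda>a. \<forall>l xs l' xs'. atom_factorization (tau_reg \<tau>) \<alpha> a l xs \<longrightarrow>
        atom_factorization (tau_reg \<tau>) \<alpha> a l' xs' \<longrightarrow> rel_mset (assoc_by \<beta>) (mset xs) (mset xs')"
  have nonregular: "?same a" if "a \<notin> Reg" for a
  proof (intro allI impI)
    fix l xs l' xs'
    assume "atom_factorization (tau_reg \<tau>) \<alpha> a l xs" "atom_factorization (tau_reg \<tau>) \<alpha> a l' xs'"
    then have f: "factorization (tau_reg \<tau>) a l xs" "factorization (tau_reg \<tau>) a l' xs'"
      by (simp_all add: atom_factorization_def)
    then have "length xs = 1" "length xs' = 1"
      using factorization_tau_reg_nontrivial that by blast+
    with f obtain x x' where x: "xs = [x]" "strongly_associate a x" "xs' = [x']" "strongly_associate a x'"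
      by (metis factorization_length_1E)
    then have "assoc_by \<beta> x x'"
      using strongly_associate_imp_assoc_by[of a _ \<beta>] equivp_assoc_by[of \<beta>]
      by (metis equivp_symp equivp_transp)
    then show "rel_mset (assoc_by \<beta>) (mset xs) (mset xs')"
      unfolding x by (intro list_all2_imp_rel_mset) simp
  qed
  have "?same a \<longleftrightarrow> (\<forall>l xs l' xs'. r_atomic_factorization \<tau> a l xs \<longrightarrow>
      r_atomic_factorization \<tau> a l' xs' \<longrightarrow> rel_mset associate (mset xs) (mset xs'))"
    if "a \<in> Reg" for a
  proof -
    have "rel_mset (assoc_by \<beta>) (mset xs) M \<longleftrightarrow> rel_mset associate (mset xs) M"
      if "r_atomic_factorization \<tau> a l xs" for l xs M
      by (rule rel_mset_cong_left)
        (use that factorization_set_Reg_nonunits[of \<tau> a l xs] in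
          \<open>auto simp: assoc_by_Reg r_atomic_factorization_def reg_factorization_def Reg_nonunits_def\<close>)
    then show ?thesis using that by (auto simp: atom_factorization_tau_reg_iff)
  qed
  then have "(\<forall>a. \<not> a dvd 1 \<longrightarrow> ?same a) \<longleftrightarrow>
      (\<forall>a l xs l' xs'. r_atomic_factorization \<tau> a l xs \<longrightarrow>
        r_atomic_factorization \<tau> a l' xs' \<longrightarrow> rel_mset associate (mset xs) (mset xs'))"
    using nonregular r_atomic_factorization_Reg_nonunits[of \<tau>]
    unfolding Reg_nonunits_def by (smt (verit) mem_Collect_eq)
  then show ?thesis by (simp add: UFR_def regular_UFR_def HFR_iff)
qed

lemma BFR_iff: "BFR (tau_reg \<tau>) \<longleftrightarrow> regular_BFR \<tau>"
proof -
  have nonregular: "\<exists>N::nat. \<forall>l xs. factorization (tau_reg \<tau>) a l xs \<longrightarrow> length xs \<le> N"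
    if "a \<notin> Reg" for a
  proof (intro exI[of _ 1] allI impI)
    fix l xs assume "factorization (tau_reg \<tau>) a l xs"
    then have "length xs = 1" using factorization_tau_reg_nontrivial that by blast
    then show "length xs \<le> 1" by simp
  qed
  have unit: "\<not> factorization \<tau> a l xs" if "a dvd 1" for a l xs
    using that by (simp add: factorization_def)
  have "BFR (tau_reg \<tau>) \<longleftrightarrow> (\<forall>a\<in>Reg_nonunits. \<exists>N::nat. \<forall>l xs. factorization \<tau> a l xs \<longrightarrow> length xs \<le> N)"
    unfolding BFR_def using nonregular
    by (intro all_nonunits_iff_ball_Reg_nonunits) (simp_all add: factorization_tau_reg_iff)
  also have "\<dots> \<longleftrightarrow> (\<forall>a\<in>Reg. \<exists>N::nat. \<forall>l xs. factorization \<tau> a l xs \<longrightarrow> length xs \<le> N)"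
    using unit unfolding Reg_nonunits_def by blast
  also have "\<dots> \<longleftrightarrow> regular_BFR \<tau>"
    by (simp add: regular_BFR_def reg_factorization_def)
  finally show ?thesis .
qed

lemma df_ring_iff: "df_ring (tau_reg \<tau>) \<alpha> \<beta> \<longleftrightarrow> regular_idf \<tau>"
proof -
  have nonregular: "finite_up_to (assoc_by \<beta>) {b. sdivisor (tau_reg \<tau>) b a \<and> atom (tau_reg \<tau>) \<alpha> b}"
    if "a \<notin> Reg" for a
  proof (rule finite_up_to_single_class[OF equivp_assoc_by, of _ _ a])
    fix b assume "b \<in> {b. sdivisor (tau_reg \<tau>) b a \<and> atom (tau_reg \<tau>) \<alpha> b}"
    then have "strongly_associate a b" using sdivisor_tau_reg_nonregular that by blast
    then show "assoc_by \<beta> b a"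
      using strongly_associate_imp_assoc_by equivp_symp[OF equivp_assoc_by] by blast
  qed
  have regular: "finite_up_to (assoc_by \<beta>) {b. sdivisor (tau_reg \<tau>) b a \<and> atom (tau_reg \<tau>) \<alpha> b} \<longleftrightarrow>
      finite_up_to associate {b. sdivisor \<tau> b a \<and> r_irreducible \<tau> b}" if "a \<in> Reg" for a
  proof -
    have "b \<in> Reg" if "sdivisor \<tau> b a" for b
      using sdivisor_dvd[OF that] Reg_dvd[OF \<open>a \<in> Reg\<close>] by blast
    then have "{b. sdivisor (tau_reg \<tau>) b a \<and> atom (tau_reg \<tau>) \<alpha> b} =
        {b. sdivisor \<tau> b a \<and> r_irreducible \<tau> b}"
      using that sdivisor_nonunits by (auto simp: sdivisor_tau_reg_iff atom_tau_reg_iff)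
    moreover have "finite_up_to (assoc_by \<beta>) {b. sdivisor \<tau> b a \<and> r_irreducible \<tau> b} \<longleftrightarrow>
        finite_up_to associate {b. sdivisor \<tau> b a \<and> r_irreducible \<tau> b}"
      by (rule finite_up_to_cong) (auto simp: assoc_by_Reg r_irreducible_def Reg_nonunits_def)
    ultimately show ?thesis by simp
  qed
  show ?thesis
    unfolding df_ring_def regular_idf_def using nonregular regular
    by (rule all_nonunits_iff_ball_Reg_nonunits)
qed

lemma U_WFFR_iff_regular_WFFR: "U_WFFR (tau_reg \<tau>) \<beta> \<longleftrightarrow> regular_WFFR \<tau>"
proof -
  have nonregular: "finite_up_to (assoc_by \<beta>) {b. essential_divisor (tau_reg \<tau>) b a}"
    if "a \<notin> Reg" for a
  proof (rule finite_up_to_single_class[OF equivp_assoc_by, of _ _ a])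
    fix b assume "b \<in> {b. essential_divisor (tau_reg \<tau>) b a}"
    then have "sdivisor (tau_reg \<tau>) b a" by (simp add: essential_divisor_tau_reg_iff)
    then have "strongly_associate a b" using sdivisor_tau_reg_nonregular that by blast
    then show "assoc_by \<beta> b a"
      using strongly_associate_imp_assoc_by equivp_symp[OF equivp_assoc_by] by blast
  qed
  have regular: "finite_up_to (assoc_by \<beta>) {b. essential_divisor (tau_reg \<tau>) b a} \<longleftrightarrow>
      finite_up_to associate {b. sdivisor \<tau> b a}" if "a \<in> Reg" for a
    unfolding essential_divisor_tau_reg_iff sdivisor_tau_reg_iff[OF that]
  proof (rule finite_up_to_cong)
    fix b c assume "b \<in> {b. sdivisor \<tau> b a}"
    then have "b dvd a" using sdivisor_dvd by blast
    with that have "b \<in> Reg" by (rule Reg_dvd)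
    then show "assoc_by \<beta> b c \<longleftrightarrow> associate b c" by (rule assoc_by_Reg)
  qed
  show ?thesis
    unfolding U_WFFR_def regular_WFFR_def using nonregular regular
    by (rule all_nonunits_iff_ball_Reg_nonunits)
qed

lemma WFFR_iff: "WFFR (tau_reg \<tau>) \<beta> \<longleftrightarrow> regular_WFFR \<tau>"
  using U_WFFR_iff U_WFFR_iff_regular_WFFR by metis

lemma FFR_iff:
  fixes \<tau> :: "('a::comm_ring_1 \<times> 'a) set"
  shows "FFR (tau_reg \<tau>) \<beta> \<longleftrightarrow> regular_FFR \<tau>"
proof -
  let ?nt = "\<lambda>a. {(l, xs). factorization (tau_reg \<tau>) a l xs \<and> length xs \<noteq> 1}"
  have nonregular: "finite_up_to (same_factorization (assoc_by \<beta>)) (?nt a)" if "a \<notin> Reg" for a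
  proof -
    have "?nt a = {}" using factorization_tau_reg_nontrivial that by auto
    then show ?thesis by (simp only: finite_up_to_empty)
  qed
  have regular: "finite_up_to (same_factorization (assoc_by \<beta>)) (?nt a) \<longleftrightarrow>
      finite_up_to (same_factorization associate) {(l, xs). factorization \<tau> a l xs}"
    if "a \<in> Reg" for a
  proof -
    have "finite_up_to (same_factorization (assoc_by \<beta>)) {(l, xs). factorization \<tau> a l xs} \<longleftrightarrow>
        finite_up_to (same_factorization associate) {(l, xs). factorization \<tau> a l xs}"
    proof (rule finite_up_to_cong)
      fix p q :: "'a \<times> 'a list" assume "p \<in> {(l, xs). factorization \<tau> a l xs}"
      then have "x \<in> Reg" if "x \<in># mset (snd p)" for x
        using factorization_set_Reg_nonunits[of \<tau> a] \<open>a \<in> Reg\<close> that by (fastforce simp: Reg_nonunits_def)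
      then have "rel_mset (assoc_by \<beta>) (mset (snd p)) (mset (snd q)) \<longleftrightarrow>
          rel_mset associate (mset (snd p)) (mset (snd q))"
        by (intro rel_mset_cong_left assoc_by_Reg)
      then show "same_factorization (assoc_by \<beta>) p q \<longleftrightarrow> same_factorization associate p q"
        by (simp add: same_factorization_def split_beta)
    qed
    then show ?thesis
      unfolding finite_up_to_nontrivial_factorizations_iff factorization_tau_reg_iff[OF that] .
  qed
  show ?thesis
    unfolding FFR_def regular_FFR_def using nonregular regular
    by (rule all_nonunits_iff_ball_Reg_nonunits)
qed

section \<open>Ascending chains\<close>

lemma sdivisor_strict_Reg:
  assumes "sdivisor (tau_reg \<tau>) b a" and "pideal a \<subset> pideal b"
  shows "a \<in> Reg"
  using assms sdivisor_tau_reg_nonregular strongly_associate_imp_associate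
  by (fastforce simp: associate_def)

lemma U_ACCP_iff_regular_ACCP: "U_ACCP (tau_reg \<tau>) \<longleftrightarrow> regular_ACCP \<tau>"
proof -
  have "pideal a \<subset> pideal b \<and> essential_divisor (tau_reg \<tau>) b a \<longleftrightarrow>
      a \<in> Reg \<and> pideal a \<subset> pideal b \<and> (\<exists>l xs. reg_factorization \<tau> a l xs \<and> b \<in> set xs)" for a b
  proof -
    have "sdivisor (tau_reg \<tau>) b a \<longleftrightarrow> (\<exists>l xs. reg_factorization \<tau> a l xs \<and> b \<in> set xs)"
      if "a \<in> Reg"
      using that by (simp add: sdivisor_tau_reg_iff) (simp add: sdivisor_def reg_factorization_def)
    then show ?thesis
      using sdivisor_strict_Reg[of \<tau> b a] unfolding essential_divisor_tau_reg_iff by blast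
  qed
  then show ?thesis unfolding U_ACCP_def regular_ACCP_def by presburger
qed

text \<open>
  This and the next lemma let a \<open>\<sigma>\<close>-divisor be carried over a stretch of a chain on which the ideals
  do not change. In general \<open>\<sigma>\<close>-divisibility is not transitive, so that strong associates are needed.
\<close>

lemma sdivisor_associate_imp_strongly_associate:
  assumes "sdivisor (tau_reg \<tau>) b a" and "associate a b"
  shows "strongly_associate a b"
  using assms sdivisor_tau_reg_nonregular associate_Reg_imp_strongly_associate by blast

lemma sdivisor_strongly_associate:
  assumes "sdivisor \<sigma> c b" and "strongly_associate a b"
  shows "sdivisor \<sigma> c a"
proof -
  obtain l xs where f: "factorization \<sigma> b l xs" "c \<in> set xs"
    using assms(1) by (auto simp: sdivisor_def)
  obtain u where u: "u dvd 1" "a = u * b" using assms(2) by (auto simp: strongly_associate_def)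
  have "associate a b" using assms(2) by (rule strongly_associate_imp_associate)
  then have "\<not> a dvd 1"
    using f by (auto simp: factorization_def associate_iff_dvd intro: dvd_trans)
  moreover have "u * l dvd 1" using u f by (metis factorization_def mult_dvd_mono mult_1)
  ultimately have "factorization \<sigma> a (u * l) xs"
    using f u by (simp add: factorization_def mult.assoc)
  with f show ?thesis by (auto simp: sdivisor_def)
qed

text \<open>
  For the converse direction, let the chain \<open>a\<close> not become constant. From any index \<open>m\<close> go to the
  first later \<open>n\<close> with a different ideal. All elements before \<open>a n\<close> are strongly associate to
  \<open>a m\<close>, so \<open>a n\<close>, being a divisor of its predecessor, is a divisor of \<open>a m\<close>. Iterating this jump gives
  a strictly ascending chain.
\<close>

lemma ACCP_iff: "ACCP (tau_reg \<tau>) \<longleftrightarrow> U_ACCP (tau_reg \<tau>)"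
proof
  assume accp: "ACCP (tau_reg \<tau>)"
  show "U_ACCP (tau_reg \<tau>)"
    unfolding U_ACCP_def
  proof
    assume "\<exists>a. \<forall>i. pideal (a i) \<subset> pideal (a (Suc i)) \<and> essential_divisor (tau_reg \<tau>) (a (Suc i)) (a i)"
    then obtain a where a: "\<forall>i. pideal (a i) \<subset> pideal (a (Suc i)) \<and>
        sdivisor (tau_reg \<tau>) (a (Suc i)) (a i)"
      unfolding essential_divisor_tau_reg_iff by blast
    then have "\<forall>i. pideal (a i) \<subseteq> pideal (a (Suc i)) \<and> sdivisor (tau_reg \<tau>) (a (Suc i)) (a i)"
      by blast
    with accp[unfolded ACCP_def, THEN spec, of a]
    have "\<exists>N. \<forall>n\<ge>N. pideal (a n) = pideal (a N)" by (rule mp)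
    then obtain N where "\<forall>n\<ge>N. pideal (a n) = pideal (a N)" ..
    then have "pideal (a (Suc N)) = pideal (a N)" using le_SucI[OF order_refl] by blast
    with a[rule_format, of N] show False by simp
  qed
next
  assume U: "U_ACCP (tau_reg \<tau>)"
  show "ACCP (tau_reg \<tau>)"
    unfolding ACCP_def
  proof (intro allI impI, rule ccontr)
    fix a :: "nat \<Rightarrow> 'a"
    assume chain: "\<forall>i. pideal (a i) \<subseteq> pideal (a (Suc i)) \<and> sdivisor (tau_reg \<tau>) (a (Suc i)) (a i)"
      and nonconst: "\<not> (\<exists>N. \<forall>n\<ge>N. pideal (a n) = pideal (a N))"
    have step: "\<exists>n. pideal (a m) \<subset> pideal (a n) \<and> sdivisor (tau_reg \<tau>) (a n) (a m)" for m
    proof -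
      define n where "n = (LEAST n. n \<ge> m \<and> pideal (a n) \<noteq> pideal (a m))"
      have ex: "\<exists>n. n \<ge> m \<and> pideal (a n) \<noteq> pideal (a m)" using nonconst by blast
      have n: "n \<ge> m" "pideal (a n) \<noteq> pideal (a m)"
        using LeastI_ex[OF ex] by (simp_all add: n_def)
      have below: "pideal (a i) = pideal (a m)" if "m \<le> i" "i < n" for i
        using not_less_Least[of i "\<lambda>n. n \<ge> m \<and> pideal (a n) \<noteq> pideal (a m)"] that by (simp add: n_def)
      have "m < n" using n by (metis le_neq_implies_less)
      then obtain k where k: "n = Suc k" "m \<le> k" by (cases n) auto
      have "strongly_associate (a m) (a i)" if "m \<le> i" "i \<le> k" for i
        using that
      proof (induction i rule: dec_induct)
        case base
        show ?case by (rule equivp_reflp[OF equivp_strongly_associate])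
      next
        case (step i)
        then have "associate (a i) (a (Suc i))"
          using below[of i] below[of "Suc i"] k by (simp add: associate_def)
        then have "strongly_associate (a i) (a (Suc i))"
          using sdivisor_associate_imp_strongly_associate chain[rule_format, of i] by blast
        moreover have "strongly_associate (a m) (a i)" using step by simp
        ultimately show ?case using equivp_transp[OF equivp_strongly_associate] by blast
      qed
      then have "strongly_associate (a m) (a k)" using k by simp
      moreover have "sdivisor (tau_reg \<tau>) (a n) (a k)" using chain[rule_format, of k] k by simp
      ultimately have "sdivisor (tau_reg \<tau>) (a n) (a m)"
        by (rule sdivisor_strongly_associate[rotated])
      moreover have "pideal (a k) \<subseteq> pideal (a n)" using chain[rule_format, of k] k by simp
      then have "pideal (a m) \<subset> pideal (a n)" using below[of k] k n(2) by simp
      ultimately show ?thesis by blast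
    qed
    then have "\<exists>f. \<forall>m. pideal (a m) \<subset> pideal (a (f m)) \<and> sdivisor (tau_reg \<tau>) (a (f m)) (a m)"
      by (intro choice allI)
    then obtain f where
      f: "\<And>m. pideal (a m) \<subset> pideal (a (f m)) \<and> sdivisor (tau_reg \<tau>) (a (f m)) (a m)"
      by blast
    define c where "c = (\<lambda>i. a ((f ^^ i) 0))"
    have "\<forall>i. pideal (c i) \<subset> pideal (c (Suc i)) \<and> essential_divisor (tau_reg \<tau>) (c (Suc i)) (c i)"
      using f by (simp add: c_def essential_divisor_tau_reg_iff)
    then have "\<not> U_ACCP (tau_reg \<tau>)"
      unfolding U_ACCP_def not_not by (intro exI[where x = c])
    then show False using U by simp
  qed
qed

section \<open>Refinable relations\<close>

text \<open>
  Refinements are chosen as functions of the factor; this loses nothing, as equal factors can be refined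
  equally, and it avoids reasoning about indices.
\<close>

lemma refinable_map:
  assumes "refinable \<tau>" and "factorization \<tau> a l xs"
    and "\<And>x. x \<in> set xs \<Longrightarrow> factorization \<tau> x (L x) (Y x)"
  shows "factorization \<tau> a (l * prod_list (map L xs)) (concat (map Y xs))"
proof -
  have "\<forall>i<length xs. factorization \<tau> (xs ! i) (map L xs ! i) (map Y xs ! i)"
    using assms(3) by simp
  then show ?thesis
    using assms(1,2) unfolding refinable_def by (metis length_map)
qed

lemma sdivisor_trans:
  assumes "refinable \<tau>" and "sdivisor \<tau> c b" and "sdivisor \<tau> b a"
  shows "sdivisor \<tau> c a"
proof -
  obtain l xs where f: "factorization \<tau> a l xs" "b \<in> set xs"
    using assms(3) by (auto simp: sdivisor_def)
  obtain m ys where g: "factorization \<tau> b m ys" "c \<in> set ys"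
    using assms(2) by (auto simp: sdivisor_def)
  let ?L = "\<lambda>x. if x = b then m else 1" and ?Y = "\<lambda>x. if x = b then ys else [x]"
  have "factorization \<tau> x (?L x) (?Y x)" if "x \<in> set xs" for x
    using that f g by (auto intro!: factorization_self simp: factorization_def)
  from refinable_map[where L = ?L and Y = ?Y, OF assms(1) f(1) this]
  have "factorization \<tau> a (l * prod_list (map ?L xs)) (concat (map ?Y xs))" .
  moreover have "c \<in> set (concat (map ?Y xs))" using f g by auto
  ultimately show ?thesis unfolding sdivisor_def by blast
qed

text \<open>
  Induction on the number of divisor classes of \<open>a\<close>. For a factor \<open>x\<close> not associate to \<open>a\<close> this number is
  smaller: by transitivity every divisor of \<open>x\<close> is one of \<open>a\<close>, and the class of \<open>a\<close> itself is lost, since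
  \<open>a\<close> dividing \<open>x\<close> would make them associate.
\<close>

lemma regular_WFFR_imp_regular_atomic:
  assumes "refinable \<tau>" and "regular_WFFR \<tau>"
  shows "regular_atomic \<tau>"
proof -
  let ?D = "\<lambda>a. (\<lambda>b. {y. associate b y}) ` {b. sdivisor \<tau> b a}"
  have fin: "finite (?D a)" if "a \<in> Reg_nonunits" for a
    using assms(2) that by (auto simp: regular_WFFR_def finite_up_to_def quotient_Collect)
  have "\<exists>l xs. r_atomic_factorization \<tau> a l xs" if "a \<in> Reg_nonunits" for a
    using that
  proof (induction "card (?D a)" arbitrary: a rule: less_induct)
    case less
    then have a: "a \<in> Reg" "\<not> a dvd 1" by (auto simp: Reg_nonunits_def)
    show ?case
    proof (cases "r_irreducible \<tau> a")
      case True
      then have "r_atomic_factorization \<tau> a 1 [a]"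
        using a by (simp add: r_atomic_factorization_def reg_factorization_def factorization_self)
      then show ?thesis by blast
    next
      case False
      then obtain l xs where f: "factorization \<tau> a l xs" and na: "\<And>x. x \<in> set xs \<Longrightarrow> \<not> associate a x"
        using a by (auto simp: r_irreducible_def Reg_nonunits_def reg_factorization_def)
      have "\<exists>m ys. r_atomic_factorization \<tau> x m ys" if x: "x \<in> set xs" for x
      proof (rule less.hyps)
        show "x \<in> Reg_nonunits" using factorization_set_Reg_nonunits f a x by blast
        have xa: "sdivisor \<tau> x a" using f x by (auto simp: sdivisor_def)
        have "?D x \<subseteq> ?D a" using sdivisor_trans[OF assms(1) _ xa] by blast
        moreover have "{y. associate a y} \<in> ?D a" using sdivisor_self a by blast
        moreover have "{y. associate a y} \<notin> ?D x"
        proof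
          assume "{y. associate a y} \<in> ?D x"
          then obtain b where "sdivisor \<tau> b x" "{y. associate a y} = {y. associate b y}" by blast
          then have "b dvd x" "associate a b"
            using sdivisor_dvd by (auto simp: associate_def)
          then have "associate a x"
            using sdivisor_dvd[OF xa] by (auto simp: associate_iff_dvd intro: dvd_trans)
          then show False using na x by blast
        qed
        ultimately have "?D x \<subset> ?D a" by blast
        then show "card (?D x) < card (?D a)"
          using fin[OF less.prems] by (rule psubset_card_mono[rotated])
      qed
      then obtain L Y where LY: "\<And>x. x \<in> set xs \<Longrightarrow> r_atomic_factorization \<tau> x (L x) (Y x)"
        by metis
      then have "factorization \<tau> a (l * prod_list (map L xs)) (concat (map Y xs))"
        using refinable_map[OF assms(1) f]
        by (simp add: r_atomic_factorization_def reg_factorization_def)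
      then have "r_atomic_factorization \<tau> a (l * prod_list (map L xs)) (concat (map Y xs))"
        using LY a by (auto simp: r_atomic_factorization_def reg_factorization_def)
      then show ?thesis by blast
    qed
  qed
  then show ?thesis by (simp add: regular_atomic_def)
qed

lemma regular_WFFR_imp_regular_idf: "regular_WFFR \<tau> \<Longrightarrow> regular_idf \<tau>"
  unfolding regular_WFFR_def regular_idf_def by (blast intro: finite_up_to_subset)

lemma regular_FFR_imp_regular_WFFR:
  assumes "regular_FFR \<tau>"
  shows "regular_WFFR \<tau>"
  unfolding regular_WFFR_def
proof
  fix a :: 'a assume "a \<in> Reg_nonunits"
  then have "finite_up_to (same_factorization associate) {(l, xs). factorization \<tau> a l xs}"
    using assms by (simp add: regular_FFR_def)
  from finite_up_to_cover[OF equivp_same_factorization[OF equivp_associate] this]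
  obtain T where T: "finite T"
    "\<forall>p\<in>{(l, xs). factorization \<tau> a l xs}. \<exists>t\<in>T. same_factorization associate p t"
    by blast
  show "finite_up_to associate {b. sdivisor \<tau> b a}"
  proof (rule finite_up_toI_cover[OF equivp_associate, of "\<Union>t\<in>T. set (snd t)"])
    show "finite (\<Union>t\<in>T. set (snd t))" using T(1) by simp
    fix b assume "b \<in> {b. sdivisor \<tau> b a}"
    then obtain l xs where f: "factorization \<tau> a l xs" "b \<in> set xs" by (auto simp: sdivisor_def)
    then obtain t where t: "t \<in> T" "same_factorization associate (l, xs) t" using T(2) by blast
    then have "rel_mset associate (mset xs) (mset (snd t))"
      by (simp add: same_factorization_def split_beta)
    then have "rel_set associate (set xs) (set (snd t))"
      using multiset.set_transfer[of associate] by (auto dest: rel_funD)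
    then obtain c where "c \<in> set (snd t)" "associate b c" using f(2) by (auto simp: rel_set_def)
    then show "\<exists>t\<in>\<Union>t\<in>T. set (snd t). associate b t" using t(1) by blast
  qed
qed

lemma nat_seq_mono_subseq:
  fixes f :: "nat \<Rightarrow> nat"
  obtains r :: "nat \<Rightarrow> nat" where "strict_mono r" "mono (\<lambda>n. f (r n))"
proof -
  obtain g :: "nat \<Rightarrow> nat" where g: "strict_mono g" "monoseq (\<lambda>n. f (g n))"
    using seq_monosub[of f] by blast
  show thesis
  proof (cases "mono (\<lambda>n. f (g n))")
    case True
    with g that show thesis by blast
  next
    case False
    then have dec: "antimono (\<lambda>n. f (g n))"
      using g(2) by (auto simp: monoseq_iff)
    \<comment> \<open>A decreasing sequence of naturals is constant from the index of its minimum on.\<close>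
    define k where "k = (ARG_MIN (\<lambda>n. f (g n)) n. True)"
    have "f (g k) \<le> f (g n)" for n
      unfolding k_def by (rule arg_min_nat_le) simp
    then have "f (g (k + n)) = f (g k)" for n
      using antimonoD[OF dec, of k "k + n"] by (simp add: le_antisym)
    then have "mono (\<lambda>n. f (g (k + n)))" by (simp add: mono_def)
    moreover have "strict_mono (\<lambda>n. g (k + n))"
      using g(1) by (simp add: strict_mono_def)
    ultimately show thesis using that[of "\<lambda>n. g (k + n)"] by simp
  qed
qed

text \<open>
  Dickson's lemma for \<open>T\<close>-indexed exponent vectors \<open>\<lambda>t. f t n\<close>, by thinning out the sequence of vectors one coordinate at a time.
\<close>

lemma Dickson_subseq:
  fixes f :: "'b \<Rightarrow> nat \<Rightarrow> nat"
  assumes "finite T"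
  shows "\<exists>r::nat \<Rightarrow> nat. strict_mono r \<and> (\<forall>t\<in>T. mono (\<lambda>n. f t (r n)))"
  using assms
proof (induction T)
  case empty
  show ?case by (auto intro!: exI[of _ "\<lambda>n. n"] simp: strict_mono_def)
next
  case (insert t T)
  then obtain r :: "nat \<Rightarrow> nat" where r: "strict_mono r" "\<And>s. s \<in> T \<Longrightarrow> mono (\<lambda>n. f s (r n))" by blast
  obtain q :: "nat \<Rightarrow> nat" where q: "strict_mono q" "mono (\<lambda>n. f t (r (q n)))"
    using nat_seq_mono_subseq[of "\<lambda>n. f t (r n)"] by blast
  have "mono (\<lambda>n. f s (r (q n)))" if "s \<in> T" for s
    using r(2)[OF that] strict_mono_mono[OF q(1)] by (auto simp: mono_def)
  moreover have "strict_mono (\<lambda>n. r (q n))" using r q by (simp add: strict_mono_def)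
  ultimately show ?case using q(2) by (intro exI[of _ "\<lambda>n. r (q n)"]) auto
qed

text \<open>
  Otherwise there is a sequence of products of unbounded length. By Dickson's lemma a longer one
  contains a shorter one as a submultiset. Both are associate to \<open>a\<close>, so cancelling the shorter makes the
  nonempty rest a unit, although it consists of non-units.
\<close>

lemma bounded_length_over_finite_set:
  assumes "a \<in> Reg" and "finite T" and nonunit: "\<And>t. t \<in> T \<Longrightarrow> \<not> t dvd 1"
  shows "\<exists>N. \<forall>xs. set xs \<subseteq> T \<longrightarrow> associate a (prod_list xs) \<longrightarrow> length xs \<le> N"
proof (rule ccontr)
  assume "\<not> ?thesis"
  then have "\<forall>N. \<exists>xs. set xs \<subseteq> T \<and> associate a (prod_list xs) \<and> length xs > N"
    by (meson not_le)
  then obtain X where X: "\<And>N. set (X N) \<subseteq> T" "\<And>N. associate a (prod_list (X N))"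
    "\<And>N. length (X N) > N"
    by metis
  obtain r :: "nat \<Rightarrow> nat" where r: "strict_mono r"
    "\<And>t. t \<in> T \<Longrightarrow> mono (\<lambda>n. count (mset (X (r n))) t)"
    using Dickson_subseq[OF assms(2), of "\<lambda>t n. count (mset (X n)) t"] by blast
  define xs where "xs = X (r 0)"
  \<comment> \<open>\<open>X N\<close> is longer than \<open>N\<close>, so this index makes \<open>ys\<close> longer than \<open>xs\<close>.\<close>
  define ys where "ys = X (r (length xs))"
  have sub: "mset xs \<subseteq># mset ys"
  proof (rule mset_subset_eqI)
    fix t
    show "count (mset xs) t \<le> count (mset ys) t"
    proof (cases "t \<in> T")
      case True
      then show ?thesis using monoD[OF r(2)[OF True], of 0 "length xs"] by (simp add: xs_def ys_def)
    next
      case False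
      then have "t \<notin> set xs" using X(1) by (auto simp: xs_def)
      then show ?thesis by (metis count_mset_0_iff le0)
    qed
  qed
  have "length xs \<le> r (length xs)" using r(1) by (rule strict_mono_imp_increasing)
  also have "\<dots> < length ys" using X(3) by (simp add: ys_def)
  finally have "mset ys - mset xs \<noteq> {#}"
    using sub by (metis size_Diff_submset size_empty size_mset zero_less_diff less_irrefl)
  then obtain t where t: "t \<in># mset ys - mset xs" by blast
  obtain zs where zs: "mset zs = mset ys - mset xs" using ex_mset by blast
  have "mset ys = mset (xs @ zs)" using sub zs by simp
  then have "prod_list ys = prod_list xs * prod_list zs"
    by (metis prod_mset_prod_list prod_list.append)
  moreover have "associate (prod_list xs) a" "associate (prod_list ys) a"
    using X(2) by (simp_all add: xs_def ys_def associate_def)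
  ultimately have "prod_list xs * prod_list zs dvd prod_list xs" "prod_list xs \<in> Reg"
    using Reg_dvd[OF assms(1)] by (auto simp: associate_iff_dvd intro: dvd_trans)
  then have "prod_list zs dvd 1" using Reg_cancel_unit by blast
  moreover have "t \<in> set zs" using t zs by (metis set_mset_mset)
  ultimately have "t dvd 1" using prod_list_dvd dvd_trans by blast
  moreover have "t \<in> T" using t in_diffD[of t "mset ys" "mset xs"] X(1) by (auto simp: ys_def)
  ultimately show False using nonunit by blast
qed

lemma associate_mult: "associate a b \<Longrightarrow> associate c d \<Longrightarrow> associate (a * c) (b * d)"
  by (simp add: associate_iff_dvd mult_dvd_mono)

lemma associate_prod_list_map:
  "(\<And>x. x \<in> set xs \<Longrightarrow> associate x (f x)) \<Longrightarrow> associate (prod_list xs) (prod_list (map f xs))"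
proof (induction xs)
  case Nil
  show ?case by (simp add: associate_def)
next
  case (Cons x xs)
  then show ?case by (simp add: associate_mult)
qed

lemma factorization_associate_prod_list:
  assumes "factorization \<sigma> a l xs"
  shows "associate a (prod_list xs)"
  using assms by (intro strongly_associate_imp_associate) (auto simp: factorization_def strongly_associate_def)

text \<open>
  Let \<open>T\<close> represent the irreducible divisors of \<open>a\<close>. Refining a factorization of \<open>a\<close> to an atomic one
  shows that it has at most \<open>N\<close> factors, each associate to a product of at most \<open>N\<close> elements of \<open>T\<close>.
\<close>

lemma regular_atomic_idf_imp_FFR:
  fixes \<tau> :: "('a::comm_ring_1 \<times> 'a) set"
  assumes "refinable \<tau>" and "regular_atomic \<tau>" and "regular_idf \<tau>"
  shows "regular_FFR \<tau>"
  unfolding regular_FFR_def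
proof
  fix a :: 'a assume a: "a \<in> Reg_nonunits"
  then have reg: "a \<in> Reg" by (simp add: Reg_nonunits_def)
  let ?P = "{p. sdivisor \<tau> p a \<and> r_irreducible \<tau> p}"
  have "finite_up_to associate ?P" using assms(3) a by (simp add: regular_idf_def)
  from finite_up_to_cover[OF equivp_associate this]
  obtain T where T: "finite T" "T \<subseteq> ?P" "\<forall>p\<in>?P. \<exists>t\<in>T. associate p t"
    by blast
  have "\<forall>p\<in>?P. \<exists>t. t \<in> T \<and> associate p t" using T(3) by blast
  from bchoice[OF this] obtain rep where "\<forall>p\<in>?P. rep p \<in> T \<and> associate p (rep p)" ..
  then have rep: "rep p \<in> T" "associate p (rep p)" if "p \<in> ?P" for p
    using that by blast+
  have "\<not> t dvd 1" if "t \<in> T" for t using T(2) that sdivisor_nonunits by blast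
  from bounded_length_over_finite_set[OF reg T(1) this]
  obtain N where "\<forall>xs. set xs \<subseteq> T \<longrightarrow> associate a (prod_list xs) \<longrightarrow> length xs \<le> N" by auto
  then have N: "length xs \<le> N" if "set xs \<subseteq> T" "associate a (prod_list xs)" for xs
    using that by blast
  define B where "B = prod_list ` {ts. set ts \<subseteq> T \<and> length ts \<le> N}"
  have "finite B" unfolding B_def using finite_lists_length_le[OF T(1)] by simp
  show "finite_up_to (same_factorization associate) {(l, xs). factorization \<tau> a l xs}"
  proof (rule finite_up_toI_cover[OF equivp_same_factorization[OF equivp_associate],
        of "Pair 1 ` {bs. set bs \<subseteq> B \<and> length bs \<le> N}"])
    show "finite (Pair (1::'a) ` {bs. set bs \<subseteq> B \<and> length bs \<le> N})"
      using finite_lists_length_le[OF \<open>finite B\<close>] by simp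
    fix p assume "p \<in> {(l, xs). factorization \<tau> a l xs}"
    then obtain l xs where p: "p = (l, xs)" and f: "factorization \<tau> a l xs" by auto
    have "\<exists>m ys. r_atomic_factorization \<tau> x m ys" if "x \<in> set xs" for x
      using assms(2) factorization_set_Reg_nonunits[OF f reg] that by (auto simp: regular_atomic_def)
    then obtain L Y where LY: "\<And>x. x \<in> set xs \<Longrightarrow> r_atomic_factorization \<tau> x (L x) (Y x)"
      by metis
    then have fx: "factorization \<tau> x (L x) (Y x)" if "x \<in> set xs" for x
      using that by (simp add: r_atomic_factorization_def reg_factorization_def)
    define zs where "zs = concat (map Y xs)"
    have fz: "factorization \<tau> a (l * prod_list (map L xs)) zs"
      unfolding zs_def using refinable_map[OF assms(1) f fx] .
    have irr: "z \<in> ?P" if "z \<in> set zs" for z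
    proof -
      have "sdivisor \<tau> z a" using fz that unfolding sdivisor_def by blast
      moreover have "r_irreducible \<tau> z"
        using that LY by (auto simp: zs_def r_atomic_factorization_def)
      ultimately show ?thesis by simp
    qed
    have "associate a (prod_list (map rep zs))"
      using factorization_associate_prod_list[OF fz] associate_prod_list_map[of zs rep] rep(2) irr
      by (simp add: associate_def)
    moreover have "set (map rep zs) \<subseteq> T" using rep(1) irr by auto
    ultimately have lenz: "length zs \<le> N" using N by fastforce
    have lenY: "length (Y x) \<le> N" if "x \<in> set xs" for x
    proof -
      have "length (Y x) \<le> length zs"
        unfolding zs_def length_concat using that by (intro member_le_sum_list) auto
      then show ?thesis using lenz by simp
    qed
    have "length xs = (\<Sum>x\<leftarrow>xs. 1)" by (simp add: sum_list_triv)
    also have "\<dots> \<le> (\<Sum>x\<leftarrow>xs. length (Y x))"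
      by (rule sum_list_mono) (use fx in \<open>simp add: factorization_def\<close>)
    also have "\<dots> = length zs" by (simp add: zs_def length_concat comp_def)
    finally have lenx: "length xs \<le> N" using lenz by simp
    define b where "b = (\<lambda>x. prod_list (map rep (Y x)))"
    have "b x \<in> B" if "x \<in> set xs" for x
      unfolding b_def B_def
      using that lenY rep(1) irr by (intro imageI) (auto simp: zs_def)
    then have "(1 :: 'a, map b xs) \<in> Pair 1 ` {bs. set bs \<subseteq> B \<and> length bs \<le> N}"
      using lenx by (intro imageI) auto
    moreover have "associate x (b x)" if "x \<in> set xs" for x
      using factorization_associate_prod_list[OF fx[OF that]] associate_prod_list_map[of "Y x" rep]
        rep(2) irr that by (auto simp: associate_def b_def zs_def)
    then have "list_all2 associate xs (map b xs)" by (simp add: list_all2_conv_all_nth)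
    then have "rel_mset associate (mset xs) (mset (map b xs))" by (rule list_all2_imp_rel_mset)
    then have "same_factorization associate p (1, map b xs)"
      by (simp add: same_factorization_def p)
    ultimately show "\<exists>t\<in>Pair 1 ` {bs. set bs \<subseteq> B \<and> length bs \<le> N}. same_factorization associate p t"
      by blast
  qed
qed

theorem corollary5p6:
  fixes \<tau> :: "('a::comm_ring_1 \<times> 'a) set"
    and \<alpha> :: atom_kind and \<beta> :: assoc_kind
  assumes "\<tau> \<subseteq> nonzero_nonunits \<times> nonzero_nonunits"
    and "sym \<tau>"
  shows
    "((U_alpha_ring (tau_reg \<tau>) \<alpha> \<longleftrightarrow> alpha_ring (tau_reg \<tau>) \<alpha>) \<and>
      (alpha_ring (tau_reg \<tau>) \<alpha> \<longleftrightarrow> regular_atomic \<tau>)) \<and>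
     ((U_ACCP (tau_reg \<tau>) \<longleftrightarrow> ACCP (tau_reg \<tau>)) \<and>
      (ACCP (tau_reg \<tau>) \<longleftrightarrow> regular_ACCP \<tau>)) \<and>
     ((U_UFR (tau_reg \<tau>) \<alpha> \<beta> \<longleftrightarrow> UFR (tau_reg \<tau>) \<alpha> \<beta>) \<and>
      (UFR (tau_reg \<tau>) \<alpha> \<beta> \<longleftrightarrow> regular_UFR \<tau>)) \<and>
     ((U_HFR (tau_reg \<tau>) \<alpha> \<longleftrightarrow> HFR (tau_reg \<tau>) \<alpha>) \<and>
      (HFR (tau_reg \<tau>) \<alpha> \<longleftrightarrow> regular_HFR \<tau>)) \<and>
     ((U_BFR (tau_reg \<tau>) \<longleftrightarrow> BFR (tau_reg \<tau>)) \<and>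
      (BFR (tau_reg \<tau>) \<longleftrightarrow> regular_BFR \<tau>)) \<and>
     ((U_df_ring (tau_reg \<tau>) \<alpha> \<beta> \<longleftrightarrow> df_ring (tau_reg \<tau>) \<alpha> \<beta>) \<and>
      (df_ring (tau_reg \<tau>) \<alpha> \<beta> \<longleftrightarrow> regular_idf \<tau>)) \<and>
     (((U_alpha_ring (tau_reg \<tau>) \<alpha> \<and> U_df_ring (tau_reg \<tau>) \<alpha> \<beta>)
         \<longleftrightarrow> (alpha_ring (tau_reg \<tau>) \<alpha> \<and> df_ring (tau_reg \<tau>) \<alpha> \<beta>)) \<and>
      ((alpha_ring (tau_reg \<tau>) \<alpha> \<and> df_ring (tau_reg \<tau>) \<alpha> \<beta>)
         \<longleftrightarrow> (regular_atomic \<tau> \<and> regular_idf \<tau>))) \<and>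
     ((U_WFFR (tau_reg \<tau>) \<beta> \<longleftrightarrow> WFFR (tau_reg \<tau>) \<beta>) \<and>
      (WFFR (tau_reg \<tau>) \<beta> \<longleftrightarrow> regular_WFFR \<tau>)) \<and>
     ((U_FFR (tau_reg \<tau>) \<beta> \<longleftrightarrow> FFR (tau_reg \<tau>) \<beta>) \<and>
      (FFR (tau_reg \<tau>) \<beta> \<longleftrightarrow> regular_FFR \<tau>)) \<and>
     (refinable \<tau> \<longrightarrow>
        ((U_alpha_ring (tau_reg \<tau>) \<alpha> \<and> U_df_ring (tau_reg \<tau>) \<alpha> \<beta>)
           \<longleftrightarrow> U_WFFR (tau_reg \<tau>) \<beta>) \<and>
        (U_WFFR (tau_reg \<tau>) \<beta> \<longleftrightarrow> U_FFR (tau_reg \<tau>) \<beta>) \<and>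
        ((alpha_ring (tau_reg \<tau>) \<alpha> \<and> df_ring (tau_reg \<tau>) \<alpha> \<beta>)
           \<longleftrightarrow> WFFR (tau_reg \<tau>) \<beta>) \<and>
        (WFFR (tau_reg \<tau>) \<beta> \<longleftrightarrow> FFR (tau_reg \<tau>) \<beta>) \<and>
        ((regular_atomic \<tau> \<and> regular_idf \<tau>) \<longleftrightarrow> regular_WFFR \<tau>) \<and>
        (regular_WFFR \<tau> \<longleftrightarrow> regular_FFR \<tau>))"
  using regular_WFFR_imp_regular_atomic[of \<tau>] regular_WFFR_imp_regular_idf[of \<tau>]
    regular_FFR_imp_regular_WFFR[of \<tau>] regular_atomic_idf_imp_FFR[of \<tau>]
  by (auto simp: U_alpha_ring_iff U_HFR_iff U_UFR_iff U_BFR_iff U_df_ring_iff U_WFFR_iff U_FFR_iff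
      alpha_ring_iff HFR_iff UFR_iff BFR_iff df_ring_iff WFFR_iff FFR_iff
      ACCP_iff U_ACCP_iff_regular_ACCP)

end
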